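(* Let $p$ be a prime, $n,m\ge 1$ integers, $\mathbb{F}=\operatorname{GF}(p^n)$ and $G=U(p^n-1)/\langle p\rangle$. Let $(S_1)$ and $(S_2)$ be suitable sequences of length $m$ on $G$, each having $1$ in the first position, and let $(\mathbb{F}^{\oplus m},A_1)$ and $(\mathbb{F}^{\oplus m},A_2)$ be the near-vector spaces determined by $(S_1)$ and $(S_2)$ respectively. Let $S_1,S_2\subseteq G$ denote the sets of distinct entries of $(S_1)$ and $(S_2)$. Then $(\mathbb{F}^{\oplus m},A_1)\cong(\mathbb{F}^{\oplus m},A_2)$ if and only if there is $q\in S_1$ such that $S_1=qS_2:=\{qq' : q'\in S_2\}$ (products taken in $G$; so in particular $|S_1|=|S_2|=:N$) and, writing $S_2=\{q'_1,\dots,q'_N\}$, for each $j=1,\dots,N$ the number of occurrences of $qq'_j$ in $(S_1)$ equals the number of occurrences of $q'_j$ in $(S_2)$.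
   Context: $U(p^n-1)=\{1\le q\le p^n-1 : \gcd(q,p^n-1)=1\}$ is the multiplicative group modulo $p^n-1$, $\langle p\rangle=\{1,p,\dots,p^{n-1}\}$ (modulo $p^n-1$) is the subgroup generated by $p$, and $G=U(p^n-1)/\langle p\rangle$. Each element of $G$ (a coset) is represented by its smallest element in $\{1,\dots,p^n-1\}$; thus $G$ is regarded as a set of integers, with product $q_iq_j$ being the smallest representative of the coset of $q_iq_j \bmod (p^n-1)$. A suitable sequence of length $m$ on $G$ is a non-decreasing sequence $(S)=(q_1,\dots,q_m)$ of integers in $U(p^n-1)$ such that each $q_i$ is the smallest element of its coset $q_i\langle p\rangle$. A near-vector space is a pair $(V,A)$ where $(V,+)$ is a group and $A$ is a set of endomorphisms of $V$ containing $0,\mathrm{id},-\mathrm{id}$, such that $A^\ast=A\setminus\{0\}$ is a subgroup of $\operatorname{Aut}(V)$, $A$ acts fixed point freely ($x\alpha=x\beta$ with $x\in V$, $\alpha,\beta\in A$ implies $x=0$ or $\alpha=\beta$), and the quasi-kernel $Q(V)=\{x\in V:\forall \alpha,\beta\in A\ \exists\gamma\in A,\ x\alpha+x\beta=x\gamma\}$ generates $V$ as a group. The near-vector space determined by a sequence $(q_1,\dots,q_m)$ with $q_i\in U(p^n-1)$ is $(\mathbb{F}^{\oplus m},A)$ with $A=\{s_\alpha:\alpha\in\mathbb{F}\}$ and $(x_1,\dots,x_m)s_\alpha=(x_1\alpha^{q_1},\dots,x_m\alpha^{q_m})$. Two near-vector spaces $(V_1,A_1)$, $(V_2,A_2)$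 are isomorphic, written $(V_1,A_1)\cong(V_2,A_2)$, if there are group isomorphisms $\theta:(V_1,+)\to(V_2,+)$ and $\eta:(A_1^\ast,\cdot)\to(A_2^\ast,\cdot)$ such that $\theta(x\alpha)=\theta(x)\eta(\alpha)$ for all $x\in V_1$, $\alpha\in A_1^\ast$. *)

theory Defs
  imports
    "HOL-Number_Theory.Totient"
    "HOL-Algebra.Bij"
    "HOL-Algebra.Product_Groups"
    "HOL-Algebra.Multiplicative_Group"
begin

section \<open>The group $U(p^n-1)/\langle p\rangle$ and suitable sequences\<close>

text \<open>
  $U(p^n-1)$ is \<^term>\<open>totatives (p ^ n - 1)\<close>, with representatives in $\{1,\dots,p^n-1\}$; for
  $p^n = 2$ this is $\{1\}$. The coset and its representative are defined for every natural number
  \<open>q\<close>, so that a product of two representatives need not be reduced first.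
\<close>

definition frob_coset :: "nat \<Rightarrow> nat \<Rightarrow> nat \<Rightarrow> nat set" where
  "frob_coset p n q = {r \<in> totatives (p ^ n - 1). \<exists>k<n. [r = q * p ^ k] (mod (p ^ n - 1))}"

definition coset_rep :: "nat \<Rightarrow> nat \<Rightarrow> nat \<Rightarrow> nat" where
  "coset_rep p n q = Min (frob_coset p n q)"

definition frob_quot :: "nat \<Rightarrow> nat \<Rightarrow> nat monoid" where
  "frob_quot p n =
     \<lparr>carrier = coset_rep p n ` totatives (p ^ n - 1),
      mult = (\<lambda>a b. coset_rep p n (a * b)),
      one = coset_rep p n 1\<rparr>"

definition suitable_seq :: "nat \<Rightarrow> nat \<Rightarrow> nat \<Rightarrow> nat list \<Rightarrow> bool" where
  "suitable_seq p n m qs \<longleftrightarrow>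
     length qs = m \<and> sorted qs \<and>
     (\<forall>q\<in>set qs. q \<in> totatives (p ^ n - 1) \<and> q = coset_rep p n q)"

section \<open>Near-vector spaces\<close>

text \<open>
  The group $(V,+)$ is written multiplicatively, as a record of HOL-Algebra. Endomorphisms are
  functions that are \<^const>\<open>extensional\<close> on the carrier, so that two of them are equal as soon as
  they agree on the carrier. Scalars act on the right in the usual notation, so a product of scalars
  \<open>\<alpha>\<beta>\<close> means that \<open>\<alpha>\<close> is applied first, whereas the product in \<^const>\<open>AutoGroup\<close> is \<open>\<alpha> \<circ> \<beta>\<close>.
  This replaces the group of scalars by its opposite, which changes neither what its subgroups are
  nor which maps between two such groups are isomorphisms.
\<close>

definition zero_endo :: "('v, 'c) monoid_scheme \<Rightarrow> 'v \<Rightarrow> 'v" where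
  "zero_endo V = (\<lambda>x\<in>carrier V. \<one>\<^bsub>V\<^esub>)"

definition id_endo :: "('v, 'c) monoid_scheme \<Rightarrow> 'v \<Rightarrow> 'v" where
  "id_endo V = (\<lambda>x\<in>carrier V. x)"

definition neg_endo :: "('v, 'c) monoid_scheme \<Rightarrow> 'v \<Rightarrow> 'v" where
  "neg_endo V = (\<lambda>x\<in>carrier V. inv\<^bsub>V\<^esub> x)"

definition quasi_kernel :: "('v, 'c) monoid_scheme \<Rightarrow> ('v \<Rightarrow> 'v) set \<Rightarrow> 'v set" where
  "quasi_kernel V A =
     {x \<in> carrier V. \<forall>\<alpha>\<in>A. \<forall>\<beta>\<in>A. \<exists>\<gamma>\<in>A. \<alpha> x \<otimes>\<^bsub>V\<^esub> \<beta> x = \<gamma> x}"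

definition near_vector_space :: "('v, 'c) monoid_scheme \<Rightarrow> ('v \<Rightarrow> 'v) set \<Rightarrow> bool" where
  "near_vector_space V A \<longleftrightarrow>
     group V \<and>
     A \<subseteq> hom V V \<inter> extensional (carrier V) \<and>
     zero_endo V \<in> A \<and> id_endo V \<in> A \<and> neg_endo V \<in> A \<and>
     subgroup (A - {zero_endo V}) (AutoGroup V) \<and>
     (\<forall>x\<in>carrier V. \<forall>\<alpha>\<in>A. \<forall>\<beta>\<in>A. \<alpha> x = \<beta> x \<longrightarrow> x = \<one>\<^bsub>V\<^esub> \<or> \<alpha> = \<beta>) \<and>
     generate V (quasi_kernel V A) = carrier V"

definition scalar_group :: "('v, 'c) monoid_scheme \<Rightarrow> ('v \<Rightarrow> 'v) set \<Rightarrow> ('v \<Rightarrow> 'v) monoid" where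
  "scalar_group V A = (AutoGroup V)\<lparr>carrier := A - {zero_endo V}\<rparr>"

definition nvs_isomorphic ::
  "('v, 'c) monoid_scheme \<Rightarrow> ('v \<Rightarrow> 'v) set \<Rightarrow> ('w, 'd) monoid_scheme \<Rightarrow> ('w \<Rightarrow> 'w) set \<Rightarrow> bool" where
  "nvs_isomorphic V1 A1 V2 A2 \<longleftrightarrow>
     near_vector_space V1 A1 \<and> near_vector_space V2 A2 \<and>
     (\<exists>\<theta>\<in>iso V1 V2. \<exists>\<eta>\<in>iso (scalar_group V1 A1) (scalar_group V2 A2).
        \<forall>x\<in>carrier V1. \<forall>\<alpha>\<in>A1 - {zero_endo V1}. \<theta> (\<alpha> x) = (\<eta> \<alpha>) (\<theta> x))"

section \<open>The near-vector space determined by a sequence\<close>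

text \<open>Coordinates are indexed by \<open>{..<m}\<close>, that is, from 0.\<close>

definition vec_group :: "('a, 'b) ring_scheme \<Rightarrow> nat \<Rightarrow> (nat \<Rightarrow> 'a) monoid" where
  "vec_group F m = product_group {..<m} (\<lambda>_. add_monoid F)"

definition seq_scalar ::
  "('a, 'b) ring_scheme \<Rightarrow> nat list \<Rightarrow> 'a \<Rightarrow> (nat \<Rightarrow> 'a) \<Rightarrow> nat \<Rightarrow> 'a" where
  "seq_scalar F qs \<alpha> =
     (\<lambda>x\<in>carrier (vec_group F (length qs)).
        \<lambda>i\<in>{..<length qs}. x i \<otimes>\<^bsub>F\<^esub> \<alpha> [^]\<^bsub>F\<^esub> (qs ! i))"

definition seq_scalars ::
  "('a, 'b) ring_scheme \<Rightarrow> nat list \<Rightarrow> ((nat \<Rightarrow> 'a) \<Rightarrow> nat \<Rightarrow> 'a) set" where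
  "seq_scalars F qs = seq_scalar F qs ` carrier F"

text \<open>
  The pair determined by a sequence in $U(|F|-1)$ is a near-vector space, so the first two conjuncts
  of \<^const>\<open>nvs_isomorphic\<close> impose nothing on such pairs.
\<close>

lemma field_pow_bij:
  fixes F :: "('a, 'b) ring_scheme" (structure)
  assumes F: "field F" and fin: "finite (carrier F)" and q: "q \<in> totatives (card (carrier F) - 1)"
  shows "bij_betw (\<lambda>a. a [^]\<^bsub>F\<^esub> q) (carrier F) (carrier F)"
proof -
  interpret field F by fact
  have q0: "q > 0" using q by (simp add: in_totatives_iff)
  have sub: "(\<lambda>a. a [^]\<^bsub>F\<^esub> q) ` carrier F \<subseteq> carrier F" by auto
  have cop: "coprime q (card (carrier F) - 1)" using q by (simp add: in_totatives_iff)
  have c1: "card (carrier F) - 1 > 0" using q by (auto simp: in_totatives_iff)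
  have fermat: "x [^] (card (carrier F) - 1) = \<one>" if "x \<in> carrier F - {\<zero>}" for x
  proof -
    have g: "group (mult_of F)" by (rule field_mult_group)
    have "x [^]\<^bsub>mult_of F\<^esub> order (mult_of F) = \<one>\<^bsub>mult_of F\<^esub>"
      using group.pow_order_eq_1[OF g] that fin by simp
    moreover have "order (mult_of F) = card (carrier F) - 1"
      using fin by (simp add: order_def)
    ultimately show ?thesis by (simp add: nat_pow_mult_of)
  qed
  obtain u v where uv: "u * q = v * (card (carrier F) - 1) + 1"
  proof -
    have "\<exists>u v. u * q = v * (card (carrier F) - 1) + 1"
      using coprime_bezout_strong[of q "card (carrier F) - 1"] cop c1 q0 bezout_nat[of q "card (carrier F) - 1"]
      by (metis coprime_iff_gcd_eq_1 mult.commute neq0_conv)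
    thus ?thesis using that by blast
  qed
  have inv: "(x [^] q) [^] u = x" if "x \<in> carrier F" for x
  proof (cases "x = \<zero>")
    case True
    have "u > 0" using uv by (cases u) auto
    thus ?thesis using True q0 by (simp add: nat_pow_zero)
  next
    case False
    have "(x [^] q) [^] u = x [^] (q * u)" using that by (simp add: nat_pow_pow)
    also have "\<dots> = x [^] (v * (card (carrier F) - 1) + 1)" using uv by (simp add: mult.commute)
    also have "\<dots> = (x [^] (card (carrier F) - 1)) [^] v \<otimes> x"
      using that by (simp add: nat_pow_pow nat_pow_mult[symmetric] mult.commute)
    also have "\<dots> = x" using fermat that False by simp
    finally show ?thesis .
  qed
  have "inj_on (\<lambda>a. a [^]\<^bsub>F\<^esub> q) (carrier F)"
    by (rule inj_on_inverseI[where g = "\<lambda>a. a [^] u"]) (rule inv)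
  thus ?thesis using sub fin by (simp add: bij_betw_def endo_inj_surj)
qed

lemma near_vector_space_seq:
  fixes F :: "('a, 'b) ring_scheme" (structure)
  assumes F: "field F" and fin: "finite (carrier F)" and len: "length qs = m" and m: "m > 0"
    and qs: "set qs \<subseteq> totatives (card (carrier F) - 1)"
  shows "near_vector_space (vec_group F m) (seq_scalars F qs)"
proof -
  interpret field F by fact
  let ?V = "vec_group F m" and ?s = "seq_scalar F qs"
  have ag: "group (add_monoid F)" by (rule add.is_group)
  have V: "group ?V" unfolding vec_group_def using ag by (intro product_group)
  interpret V: group ?V by (rule V)
  have cV: "carrier ?V = {..<m} \<rightarrow>\<^sub>E carrier F" by (simp add: vec_group_def)
  have mV: "x \<otimes>\<^bsub>?V\<^esub> y = (\<lambda>i\<in>{..<m}. x i \<oplus> y i)" for x y by (simp add: vec_group_def)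
  have oV: "\<one>\<^bsub>?V\<^esub> = (\<lambda>i\<in>{..<m}. \<zero>)" by (simp add: vec_group_def)
  have iV: "inv\<^bsub>?V\<^esub> x = (\<lambda>i\<in>{..<m}. \<ominus> x i)" if "x \<in> carrier ?V" for x
    using inv_product_group[of x "{..<m}" "\<lambda>_. add_monoid F"] that ag by (simp add: vec_group_def a_inv_def)
  have q: "qs ! i \<in> totatives (card (carrier F) - 1)" if "i < m" for i
    using that qs len by (meson nth_mem subsetD)
  have q0: "qs ! i > 0" if "i < m" for i using q[OF that] by (simp add: in_totatives_iff)
  have bij: "bij_betw (\<lambda>a. a [^] (qs ! i)) (carrier F) (carrier F)" if "i < m" for i
    using field_pow_bij[OF F fin q[OF that]] .
  have inj: "a = b" if "i < m" "a [^] (qs ! i) = b [^] (qs ! i)" "a \<in> carrier F" "b \<in> carrier F" for a b i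
    using bij[OF that(1)] that by (auto simp: bij_betw_def inj_on_def)
  have surj: "\<exists>b\<in>carrier F. b [^] (qs ! i) = a" if "i < m" "a \<in> carrier F" for a i
    using bij_betw_imp_surj_on[OF bij[OF that(1)]] that(2) by (metis (no_types, lifting) imageE)
  have s: "?s a x = (\<lambda>i\<in>{..<m}. x i \<otimes> a [^] (qs ! i))" if "x \<in> carrier ?V" for a x
    using that len by (simp add: seq_scalar_def)
  have sc: "?s a x \<in> carrier ?V" if "x \<in> carrier ?V" "a \<in> carrier F" for a x
    using that by (auto simp: s cV)
  have ext: "?s a \<in> extensional (carrier ?V)" for a
    using len by (simp add: seq_scalar_def)
  have eqI: "f = g" if "f \<in> extensional (carrier ?V)" "g \<in> extensional (carrier ?V)"
     "\<And>x. x \<in> carrier ?V \<Longrightarrow> f x = g x" for f g :: "(nat \<Rightarrow> 'a) \<Rightarrow> nat \<Rightarrow> 'a"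
    using that by (rule extensionalityI)
  have VI: "x i \<in> carrier F" if "x \<in> carrier ?V" "i < m" for x i
    using that by (auto simp: cV)
  have hom: "?s a \<in> hom ?V ?V" if "a \<in> carrier F" for a
  proof (rule homI)
    fix x y assume x: "x \<in> carrier ?V" and y: "y \<in> carrier ?V"
    show "?s a (x \<otimes>\<^bsub>?V\<^esub> y) = ?s a x \<otimes>\<^bsub>?V\<^esub> ?s a y"
      using x y V.m_closed[OF x y] that
      by (auto simp: s mV l_distr VI intro!: restrict_ext)
  qed (use sc that in auto)
  have z0: "\<zero> [^] (qs ! i) = \<zero>" if "i < m" for i using q0[OF that] by (simp add: nat_pow_zero)
  have z: "zero_endo ?V = ?s \<zero>"
    by (rule eqI) (auto simp: zero_endo_def ext s oV z0 VI intro!: restrict_ext)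
  have i: "id_endo ?V = ?s \<one>"
  proof (rule eqI)
    fix x assume x: "x \<in> carrier ?V"
    show "id_endo ?V x = ?s \<one> x"
      using x by (auto simp: id_endo_def s cV PiE_def Pi_def extensional_def fun_eq_iff)
  qed (auto simp: id_endo_def ext)
  have neg1: "(\<ominus> \<one>) [^] (qs ! i) = \<ominus> \<one>" if im: "i < m" for i
  proof -
    obtain b where b: "b \<in> carrier F" "b [^] (qs ! i) = \<ominus> \<one>" using surj[OF im, of "\<ominus> \<one>"] by auto
    have mm: "(\<ominus> \<one>) \<otimes> (\<ominus> \<one>) = \<one>" by (simp add: l_minus r_minus)
    have "(b \<otimes> b) [^] (qs ! i) = \<one> [^] (qs ! i)" using b mm by (simp add: nat_pow_distrib)
    hence "b \<otimes> b = \<one>" using inj[OF im] b by auto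
    have "(b \<oplus> \<one>) \<otimes> (b \<ominus> \<one>) = b \<otimes> b \<ominus> \<one>" using b(1) by algebra
    with \<open>b \<otimes> b = \<one>\<close> have "(b \<oplus> \<one>) \<otimes> (b \<ominus> \<one>) = \<zero>" by (simp add: r_neg minus_eq)
    hence "b \<oplus> \<one> = \<zero> \<or> b \<ominus> \<one> = \<zero>"
      using b(1) integral[of "b \<oplus> \<one>" "b \<ominus> \<one>"] by blast
    thus ?thesis
    proof
      assume "b \<oplus> \<one> = \<zero>" hence "b = \<ominus> \<one>" using b(1) by (simp add: minus_equality)
      thus ?thesis using b by simp
    next
      assume "b \<ominus> \<one> = \<zero>" hence "b = \<one>" using b(1) by simp
      hence "\<ominus> \<one> = \<one>" using b by simp
      thus ?thesis by simp
    qed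
  qed
  have ng: "neg_endo ?V = ?s (\<ominus> \<one>)"
  proof (rule eqI)
    fix x assume x: "x \<in> carrier ?V"
    show "neg_endo ?V x = ?s (\<ominus> \<one>) x"
      using x by (auto simp: neg_endo_def s iV neg1 VI r_minus intro!: restrict_ext)
  qed (auto simp: neg_endo_def ext)
  have comp: "compose (carrier ?V) (?s a) (?s b) = ?s (a \<otimes> b)" if ab: "a \<in> carrier F" "b \<in> carrier F" for a b
  proof (rule eqI)
    fix x assume x: "x \<in> carrier ?V"
    show "compose (carrier ?V) (?s a) (?s b) x = ?s (a \<otimes> b) x"
      using x ab sc[OF x ab(2)]
      by (auto simp: compose_def s nat_pow_distrib VI m_assoc m_comm m_lcomm intro!: restrict_ext)
  qed (auto simp: ext compose_extensional)
  have fpf: "x = \<one>\<^bsub>?V\<^esub> \<or> a = b" if x: "x \<in> carrier ?V" and ab: "a \<in> carrier F" "b \<in> carrier F"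
    and e: "?s a x = ?s b x" for x a b
  proof (rule disjCI)
    assume ne: "a \<noteq> b"
    have "x i = \<zero>" if "i < m" for i
    proof -
      have "x i \<otimes> a [^] (qs ! i) = x i \<otimes> b [^] (qs ! i)"
        using fun_cong[OF e, of i] x that by (simp add: s)
      thus ?thesis using inj[OF that _ ab] ne VI[OF x that] ab
        by (metis m_lcancel nat_pow_closed)
    qed
    thus "x = \<one>\<^bsub>?V\<^esub>" using x by (auto simp: oV cV PiE_def extensional_def fun_eq_iff)
  qed
  define e where "e = (\<lambda>j c. \<lambda>i\<in>{..<m}. if i = j then c else \<zero>)"
  have eV: "e j c \<in> carrier ?V" if "c \<in> carrier F" for j c using that by (auto simp: e_def cV)
  have sinj: "a = b" if "?s a = ?s b" "a \<in> carrier F" "b \<in> carrier F" for a b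
  proof -
    have "e 0 \<one> \<noteq> \<one>\<^bsub>?V\<^esub>"
      using m by (auto simp: e_def oV fun_eq_iff restrict_def intro!: exI[of _ 0])
    thus ?thesis using fpf[OF eV[OF one_closed] that(2,3), of 0] that(1) by simp
  qed
  have star: "seq_scalars F qs - {zero_endo ?V} = ?s ` (carrier F - {\<zero>})"
    unfolding z seq_scalars_def using sinj by auto
  have sBij: "?s a \<in> auto ?V" if a: "a \<in> carrier F - {\<zero>}" for a
  proof -
    have iv: "inv a \<in> carrier F" "inv a \<otimes> a = \<one>" "a \<otimes> inv a = \<one>"
      using a field_Units by (auto simp: Units_l_inv Units_r_inv)
    have "bij_betw (?s a) (carrier ?V) (carrier ?V)"
    proof (rule bij_betw_byWitness[where f' = "?s (inv a)"])
      show "\<forall>x\<in>carrier ?V. ?s (inv a) (?s a x) = x"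
      proof
        fix x assume x: "x \<in> carrier ?V"
        have "?s (inv a) (?s a x) = compose (carrier ?V) (?s (inv a)) (?s a) x"
          using x by (simp add: compose_def)
        also have "\<dots> = id_endo ?V x" using comp[of "inv a" a] iv a i by simp
        finally show "?s (inv a) (?s a x) = x" using x by (simp add: id_endo_def)
      qed
      show "\<forall>x\<in>carrier ?V. ?s a (?s (inv a) x) = x"
      proof
        fix x assume x: "x \<in> carrier ?V"
        have "?s a (?s (inv a) x) = compose (carrier ?V) (?s a) (?s (inv a)) x"
          using x by (simp add: compose_def)
        also have "\<dots> = id_endo ?V x" using comp[of a "inv a"] iv a i by simp
        finally show "?s a (?s (inv a) x) = x" using x by (simp add: id_endo_def)
      qed
    qed (use sc a iv in auto)
    thus ?thesis using hom a ext by (auto simp: auto_def Bij_def)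
  qed
  have AG: "group (AutoGroup ?V)" by (rule V.AutoGroup)
  have AGm: "?s a \<otimes>\<^bsub>AutoGroup ?V\<^esub> ?s b = ?s (a \<otimes> b)" if "a \<in> carrier F - {\<zero>}" "b \<in> carrier F - {\<zero>}" for a b
    using that sBij[of a] sBij[of b] comp[of a b] by (simp add: AutoGroup_def BijGroup_def auto_def)
  have AG1: "\<one>\<^bsub>AutoGroup ?V\<^esub> = ?s \<one>"
    using i by (simp add: AutoGroup_def BijGroup_def id_endo_def)
  have AGc: "?s a \<in> carrier (AutoGroup ?V)" if "a \<in> carrier F - {\<zero>}" for a
    using sBij[OF that] by (simp add: AutoGroup_def)
  have sub: "subgroup (?s ` (carrier F - {\<zero>})) (AutoGroup ?V)"
  proof (rule group.subgroupI[OF AG])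
    show "?s ` (carrier F - {\<zero>}) \<subseteq> carrier (AutoGroup ?V)" using AGc by auto
    show "?s ` (carrier F - {\<zero>}) \<noteq> {}" using one_closed one_not_zero by blast
  next
    fix f assume "f \<in> ?s ` (carrier F - {\<zero>})"
    then obtain a where a: "a \<in> carrier F - {\<zero>}" "f = ?s a" by auto
    have iv: "inv a \<in> carrier F - {\<zero>}" "inv a \<otimes> a = \<one>"
      using a field_Units Units_inv_Units[of a] by (auto simp: Units_l_inv)
    have "inv\<^bsub>AutoGroup ?V\<^esub> f = ?s (inv a)"
      using group.inv_equality[OF AG, of "?s (inv a)" f] a iv AGc AGm AG1 by simp
    thus "inv\<^bsub>AutoGroup ?V\<^esub> f \<in> ?s ` (carrier F - {\<zero>})" using iv by auto
  next
    fix f g assume "f \<in> ?s ` (carrier F - {\<zero>})" "g \<in> ?s ` (carrier F - {\<zero>})"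
    then obtain a b where ab: "a \<in> carrier F - {\<zero>}" "f = ?s a" "b \<in> carrier F - {\<zero>}" "g = ?s b" by auto
    have "a \<otimes> b \<in> carrier F - {\<zero>}" using ab integral by auto
    thus "f \<otimes>\<^bsub>AutoGroup ?V\<^esub> g \<in> ?s ` (carrier F - {\<zero>})" using ab AGm by auto
  qed
  have eQ: "e j c \<in> quasi_kernel ?V (seq_scalars F qs)" if c: "c \<in> carrier F" and j: "j < m" for j c
  proof -
    have "\<exists>g\<in>carrier F. ?s a (e j c) \<otimes>\<^bsub>?V\<^esub> ?s b (e j c) = ?s g (e j c)"
      if ab: "a \<in> carrier F" "b \<in> carrier F" for a b
    proof -
      obtain g where g: "g \<in> carrier F" "g [^] (qs ! j) = a [^] (qs ! j) \<oplus> b [^] (qs ! j)"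
        using surj[OF j, of "a [^] (qs ! j) \<oplus> b [^] (qs ! j)"] ab by auto
      have "?s a (e j c) \<otimes>\<^bsub>?V\<^esub> ?s b (e j c) = ?s g (e j c)"
        using ab g c eV[OF c, of j] by (auto simp: s mV e_def r_distr intro!: restrict_ext)
      thus ?thesis using g by blast
    qed
    thus ?thesis using eV[OF c] by (auto simp: quasi_kernel_def seq_scalars_def)
  qed
  have gen: "x \<in> generate ?V (quasi_kernel ?V (seq_scalars F qs))" if x: "x \<in> carrier ?V" for x
  proof -
    have "(\<lambda>i\<in>{..<m}. if i < k then x i else \<zero>) \<in> generate ?V (quasi_kernel ?V (seq_scalars F qs))" if "k \<le> m" for k
      using that
    proof (induction k)
      case 0
      show ?case using generate.one[of ?V "quasi_kernel ?V (seq_scalars F qs)"] oV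
        by (simp add: restrict_def)
    next
      case (Suc k)
      have "(\<lambda>i\<in>{..<m}. if i < k then x i else \<zero>) \<otimes>\<^bsub>?V\<^esub> e k (x k) = (\<lambda>i\<in>{..<m}. if i < Suc k then x i else \<zero>)"
        using x VI[OF x] Suc.prems by (auto simp: mV e_def less_Suc_eq intro!: restrict_ext)
      moreover have "(\<lambda>i\<in>{..<m}. if i < k then x i else \<zero>) \<in> generate ?V (quasi_kernel ?V (seq_scalars F qs))"
        by (rule Suc.IH) (use Suc.prems in simp)
      moreover have "e k (x k) \<in> generate ?V (quasi_kernel ?V (seq_scalars F qs))"
        by (rule generate.incl, rule eQ, rule VI[OF x]) (use Suc.prems in simp_all)
      ultimately show ?case
        using generate.eng[of "\<lambda>i\<in>{..<m}. if i < k then x i else \<zero>" ?V _ "e k (x k)"] by (simp only:)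
    qed
    from this[of m] have "(\<lambda>i\<in>{..<m}. if i < m then x i else \<zero>) \<in> generate ?V (quasi_kernel ?V (seq_scalars F qs))"
      by (simp only: order.refl)
    moreover have "(\<lambda>i\<in>{..<m}. if i < m then x i else \<zero>) = x"
      using x by (auto simp: cV PiE_def extensional_def fun_eq_iff)
    ultimately show ?thesis by (simp only:)
  qed
  have gs: "generate ?V (quasi_kernel ?V (seq_scalars F qs)) = carrier ?V"
    using gen V.generate_incl[of "quasi_kernel ?V (seq_scalars F qs)"] by (auto simp: quasi_kernel_def)
  show ?thesis
    unfolding near_vector_space_def
    apply (intro conjI)
    subgoal by (rule V)
    subgoal using hom ext by (auto simp: seq_scalars_def)
    subgoal by (simp add: z seq_scalars_def)
    subgoal by (simp add: i seq_scalars_def)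
    subgoal by (simp add: ng seq_scalars_def)
    subgoal unfolding star by (rule sub)
    subgoal using fpf by (auto simp: seq_scalars_def)
    subgoal by (rule gs)
    done
qed

end

theory Submission
  imports Defs "HOL-Combinatorics.Permutations"
begin

text \<open>
  The scalar groups are copies of the cyclic group of nonzero field elements, so an isomorphism is an
  additive bijection \<open>\<theta>\<close> that turns the action of \<open>a\<close> into the action of \<open>a^k\<close> for some \<open>k\<close> prime to
  \<open>p^n - 1\<close>. Each matrix entry \<open>h\<close> of \<open>\<theta>\<close> satisfies \<open>h (x a^s) = h x a^(k t)\<close>, where \<open>s\<close> and \<open>t\<close> are
  entries of the two sequences; if it is nonzero, it is a multiple of a power map that is additive,
  hence a power of Frobenius, and so \<open>s\<close> and \<open>k t\<close> lie in the same coset. Thus \<open>\<theta>\<close> is block diagonal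
  with respect to cosets, and comparing dimensions gives the count of each coset. Conversely, a bijection of
  the indices that respects cosets yields an isomorphism that permutes the coordinates and
  applies a power of Frobenius to each of them.
\<close>

section \<open>Cosets of the powers of \<open>p\<close>\<close>

lemma ex_totative_cong:
  assumes "coprime a M" "M > 0"
  shows "\<exists>r\<in>totatives M. [r = a] (mod M)"
\<comment> \<open>The residue 0 does not belong to \<open>totatives M\<close>. It can occur only for
  \<open>M = 1\<close>, where the representative is 1 instead.\<close>
proof (cases "a mod M = 0")
  case True
  then have "M dvd a" by auto
  then have "M = 1" using coprime_common_divisor[OF assms(1), of M] by simp
  then show ?thesis by (auto intro: bexI[of _ 1])
next
  case False
  have "coprime (a mod M) M" using assms by simp
  then show ?thesis
    using False assms by (intro bexI[of _ "a mod M"]) (auto simp: in_totatives_iff order_less_imp_le)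
qed

text \<open>Not restricted to \<open>totatives\<close>, so that unreduced products such as
  \<open>k * qs2 ! j\<close> can be compared directly with entries of a sequence.\<close>

definition frob_equiv :: "nat \<Rightarrow> nat \<Rightarrow> nat \<Rightarrow> nat \<Rightarrow> bool" where
  "frob_equiv p n a b \<longleftrightarrow> (\<exists>k<n. [a = b * p ^ k] (mod (p ^ n - 1)))"

lemma frob_coset_eq: "frob_coset p n q = {r \<in> totatives (p ^ n - 1). frob_equiv p n r q}"
  by (simp add: frob_coset_def frob_equiv_def)

context
  fixes p n :: nat
  assumes p1: "p > 1" and n0: "n > 0"
begin

lemma pow_minus_one_pos: "p ^ n - 1 > 0"
  using one_less_power[OF p1 n0] by simp

lemma pow_cong_one: "[p ^ n = 1] (mod (p ^ n - 1))"
proof -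
  have "[M + 1 = 1] (mod M)" for M :: nat unfolding cong_def by (rule mod_add_self1)
  from this[of "p ^ n - 1"] show ?thesis using p1 by simp
qed

lemma coprime_pow_minus_one: "coprime (p ^ k) (p ^ n - 1)"
proof -
  have "coprime (p ^ n) (p ^ n - 1)"
    using p1 by (intro coprime_diff_one_right_nat) simp
  then show ?thesis using n0 by simp
qed

text \<open>Since \<open>p ^ n\<close> is 1 modulo \<open>p ^ n - 1\<close>, the exponent may be
  reduced modulo \<open>n\<close>; this lifts the bound \<open>k < n\<close> in later
  arguments.\<close>

lemma frob_equivI:
  assumes "[a = b * p ^ k] (mod (p ^ n - 1))"
  shows "frob_equiv p n a b"
proof -
  have "[(p ^ n) ^ (k div n) * p ^ (k mod n) = 1 ^ (k div n) * p ^ (k mod n)] (mod (p ^ n - 1))"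
    by (intro cong_mult cong_pow pow_cong_one cong_refl)
  moreover have "(p ^ n) ^ (k div n) * p ^ (k mod n) = p ^ k"
    by (simp flip: power_mult power_add)
  ultimately have "[b * p ^ k = b * p ^ (k mod n)] (mod (p ^ n - 1))"
    by (intro cong_scalar_left) simp
  then have "[a = b * p ^ (k mod n)] (mod (p ^ n - 1))"
    using assms by (rule cong_trans[rotated])
  then show ?thesis using n0 by (auto simp: frob_equiv_def intro!: exI[of _ "k mod n"])
qed

lemma cong_imp_frob_equiv: "[a = b] (mod (p ^ n - 1)) \<Longrightarrow> frob_equiv p n a b"
  by (rule frob_equivI[of _ _ 0]) simp

text \<open>Modulo \<open>p ^ n - 1\<close> the inverse of \<open>p ^ k\<close> is
  \<open>p ^ (n - k)\<close>, because their product is \<open>p ^ n\<close>.\<close>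

lemma frob_equiv_sym:
  assumes "frob_equiv p n a b"
  shows "frob_equiv p n b a"
proof -
  obtain k where k: "k < n" "[a = b * p ^ k] (mod (p ^ n - 1))"
    using assms by (auto simp: frob_equiv_def)
  have "[a * p ^ (n - k) = b * p ^ k * p ^ (n - k)] (mod (p ^ n - 1))"
    using k(2) by (rule cong_scalar_right)
  also have "b * p ^ k * p ^ (n - k) = b * p ^ n"
    using k(1) by (simp add: mult.assoc flip: power_add)
  also have "[b * p ^ n = b * 1] (mod (p ^ n - 1))"
    by (intro cong_scalar_left pow_cong_one)
  finally show ?thesis
    by (intro frob_equivI[of _ _ "n - k"]) (simp add: cong_sym)
qed

lemma frob_equiv_trans:
  assumes "frob_equiv p n a b" "frob_equiv p n b c"
  shows "frob_equiv p n a c"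
proof -
  obtain k l where k: "[a = b * p ^ k] (mod (p ^ n - 1))" and l: "[b = c * p ^ l] (mod (p ^ n - 1))"
    using assms by (auto simp: frob_equiv_def)
  have "[b * p ^ k = c * p ^ l * p ^ k] (mod (p ^ n - 1))"
    using l by (rule cong_scalar_right)
  then show ?thesis
    using cong_trans[OF k] by (intro frob_equivI[of _ _ "l + k"]) (simp add: power_add mult.assoc)
qed

lemma frob_equiv_mult_left:
  assumes "frob_equiv p n a b"
  shows "frob_equiv p n (c * a) (c * b)"
  using assms by (auto simp: frob_equiv_def mult.assoc intro: cong_scalar_left)

lemma frob_equiv_mult_left_cancel:
  assumes "frob_equiv p n (c * a) (c * b)" "coprime c (p ^ n - 1)"
  shows "frob_equiv p n a b"
  using assms by (auto simp: frob_equiv_def mult.assoc cong_mult_lcancel_nat)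

lemma coset_rep_in_coset:
  assumes "coprime a (p ^ n - 1)"
  shows "coset_rep p n a \<in> totatives (p ^ n - 1)" "frob_equiv p n (coset_rep p n a) a"
proof -
  obtain r where "r \<in> totatives (p ^ n - 1)" "[r = a] (mod (p ^ n - 1))"
    using ex_totative_cong[OF assms pow_minus_one_pos] by auto
  \<comment> \<open>The reduced form of \<open>a\<close> lies in its own coset, so
    \<open>Min\<close> is taken over a nonempty set.\<close>
  then have "frob_coset p n a \<noteq> {}"
    using cong_imp_frob_equiv by (auto simp: frob_coset_eq)
  moreover have "finite (frob_coset p n a)"
    by (simp add: frob_coset_eq)
  ultimately have "coset_rep p n a \<in> frob_coset p n a"
    unfolding coset_rep_def by (rule Min_in[rotated])
  then show "coset_rep p n a \<in> totatives (p ^ n - 1)" "frob_equiv p n (coset_rep p n a) a"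
    by (auto simp: frob_coset_eq)
qed

lemma coset_rep_eqI:
  assumes "frob_equiv p n a b"
  shows "coset_rep p n a = coset_rep p n b"
proof -
  have "frob_coset p n a = frob_coset p n b"
    unfolding frob_coset_eq using assms frob_equiv_sym frob_equiv_trans by blast
  then show ?thesis by (simp add: coset_rep_def)
qed

lemma coset_rep_eq_iff:
  assumes "coprime a (p ^ n - 1)" "coprime b (p ^ n - 1)"
  shows "coset_rep p n a = coset_rep p n b \<longleftrightarrow> frob_equiv p n a b"
proof
  assume "coset_rep p n a = coset_rep p n b"
  then have "frob_equiv p n (coset_rep p n a) b"
    using coset_rep_in_coset(2)[OF assms(2)] by simp
  then show "frob_equiv p n a b"
    using coset_rep_in_coset(2)[OF assms(1)] frob_equiv_sym frob_equiv_trans by blast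
qed (rule coset_rep_eqI)

end

section \<open>Additive power maps on a finite field\<close>

text \<open>Induction by Pascal's rule: multiplying the sum by \<open>x\<close> shifts the power of
  \<open>x\<close> by one, multiplying by \<open>y\<close> does not, and the two sums are then added
  index by index.\<close>

lemma (in cring) binomial_expansion:
  assumes x: "x \<in> carrier R" and y: "y \<in> carrier R"
  shows "(x \<oplus> y) [^] (n::nat) = (\<Oplus>i\<in>{..n}. [(n choose i)] \<cdot> (x [^] i \<otimes> y [^] (n - i)))"
proof (induction n)
  case 0
  then show ?case by simp
next
  case (Suc n)
  let ?t = "\<lambda>i. x [^] i \<otimes> y [^] (n - i)" and ?u = "\<lambda>i. x [^] i \<otimes> y [^] (Suc n - i)"
  have c: "?t i \<in> carrier R" "?u i \<in> carrier R" for i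
    using x y by auto
  have X: "(\<Oplus>i\<in>{..n}. [(n choose i)] \<cdot> ?t i) \<otimes> x = (\<Oplus>i\<in>{..n}. [(n choose i)] \<cdot> ?u (Suc i))"
    using x y c by (subst finsum_ldistr) (auto intro!: add.finprod_cong' simp: add_pow_ldistr add_pow_rdistr m_ac)
  have "(\<Oplus>i\<in>{..n}. [(n choose i)] \<cdot> ?t i) \<otimes> y = (\<Oplus>i\<in>{..n}. [(n choose i)] \<cdot> ?u i)"
    using x y c by (subst finsum_ldistr) (auto intro!: add.finprod_cong' simp: add_pow_ldistr add_pow_rdistr m_ac Suc_diff_le)
  \<comment> \<open>The new last term has binomial coefficient 0. It is added so that the term of
    index 0 can be split off and the remaining indices match those of \<open>X\<close>.\<close>
  also have "\<dots> = (\<Oplus>i\<in>{..Suc n}. [(n choose i)] \<cdot> ?u i)"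
    using x y c by (subst finsum_Suc) (auto simp: binomial_eq_0)
  also have "\<dots> = (\<Oplus>i\<in>{..n}. [(n choose Suc i)] \<cdot> ?u (Suc i)) \<oplus> ?u 0"
    using x y c by (subst finsum_Suc2) auto
  finally have Y: "(\<Oplus>i\<in>{..n}. [(n choose i)] \<cdot> ?t i) \<otimes> y
      = (\<Oplus>i\<in>{..n}. [(n choose Suc i)] \<cdot> ?u (Suc i)) \<oplus> ?u 0" .
  have "(x \<oplus> y) [^] Suc n = (\<Oplus>i\<in>{..n}. [(n choose i)] \<cdot> ?t i) \<otimes> (x \<oplus> y)"
    using Suc.IH by simp
  also have "\<dots> = (\<Oplus>i\<in>{..n}. [(n choose i)] \<cdot> ?u (Suc i))
      \<oplus> (\<Oplus>i\<in>{..n}. [(n choose Suc i)] \<cdot> ?u (Suc i)) \<oplus> ?u 0"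
    using x y c by (subst r_distr) (auto simp: X Y a_assoc)
  also have "\<dots> = (\<Oplus>i\<in>{..n}. [(Suc n choose Suc i)] \<cdot> ?u (Suc i)) \<oplus> ?u 0"
    using x y c
    by (subst finsum_addf[symmetric]) (auto intro!: arg_cong2[where f = "(\<oplus>)"] add.finprod_cong'
          simp: add.nat_pow_mult)
  also have "\<dots> = (\<Oplus>i\<in>{..Suc n}. [(Suc n choose i)] \<cdot> ?u i)"
    using x y c by (subst finsum_Suc2) auto
  finally show ?case .
qed

lemma (in cring) add_pow_char_dvd:
  assumes "[(p::nat)] \<cdot> \<one> = \<zero>" "p dvd k" "x \<in> carrier R"
  shows "[k] \<cdot> x = \<zero>"
proof -
  have "[k] \<cdot> x = [k] \<cdot> \<one> \<otimes> x"
    using assms(3) by (simp add: add_pow_ldistr)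
  moreover have "[k] \<cdot> \<one> = \<zero>"
    using assms(1,2) by (auto elim!: dvdE simp flip: add.nat_pow_pow)
  ultimately show ?thesis
    using assms(3) by simp
qed

lemma (in cring) frobenius_add:
  assumes p: "prime (p::nat)" "[p] \<cdot> \<one> = \<zero>" and x: "x \<in> carrier R" and y: "y \<in> carrier R"
  shows "(x \<oplus> y) [^] (p ^ l) = x [^] (p ^ l) \<oplus> y [^] (p ^ l)"
proof (induction l)
  case 0
  then show ?case using x y by simp
next
  case (Suc l)
  have p0: "p > 0" using p(1) by (rule prime_gt_0_nat)
  have F: "(a \<oplus> b) [^] p = a [^] p \<oplus> b [^] p" if a: "a \<in> carrier R" and b: "b \<in> carrier R" for a b
  proof -
    let ?f = "\<lambda>i. [(p choose i)] \<cdot> (a [^] i \<otimes> b [^] (p - i))"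
    have f: "?f i \<in> carrier R" for i using a b by auto
    have "(a \<oplus> b) [^] p = (\<Oplus>i\<in>{..p}. ?f i)"
      by (rule binomial_expansion[OF a b])
    \<comment> \<open>For \<open>0 < i < p\<close> the prime \<open>p\<close> divides the binomial
      coefficient, which annihilates the term.\<close>
    also have "\<dots> = (\<Oplus>i\<in>{0, p}. ?f i)"
    proof (rule add.finprod_mono_neutral_cong_right)
      show "\<And>i. i \<in> {..p} - {0, p} \<Longrightarrow> ?f i = \<zero>"
        using p a b by (intro add_pow_char_dvd[OF p(2)] dvd_choose_prime) auto
    qed (use f in auto)
    also have "\<dots> = a [^] p \<oplus> b [^] p"
      using a b f p0 by (simp add: a_comm)
    finally show ?thesis .
  qed
  have "(x \<oplus> y) [^] (p ^ Suc l) = ((x \<oplus> y) [^] (p ^ l)) [^] p"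
    using x y by (simp add: nat_pow_pow mult.commute)
  also have "\<dots> = (x [^] (p ^ l)) [^] p \<oplus> (y [^] (p ^ l)) [^] p"
    using x y by (simp add: Suc F)
  also have "\<dots> = x [^] (p ^ Suc l) \<oplus> y [^] (p ^ Suc l)"
    using x y by (simp add: nat_pow_pow mult.commute)
  finally show ?case .
qed

text \<open>A nonzero polynomial of degree at most \<open>d\<close> over a domain has at most
  \<open>d\<close> roots, whereas here every one of the more than \<open>d\<close> elements would be
  a root.\<close>

lemma (in domain) vanishing_polynomial_function:
  assumes fin: "finite (carrier R)" and d: "d < card (carrier R)" and c: "\<And>i. c i \<in> carrier R"
    and z: "\<And>x. x \<in> carrier R \<Longrightarrow> (\<Oplus>i\<in>{..d}. c i \<otimes> x [^] (i::nat)) = \<zero>"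
    and i: "i \<le> d"
  shows "c i = \<zero>"
proof (rule ccontr)
  assume ne: "c i \<noteq> \<zero>"
  interpret U: UP_domain R "UP R" by unfold_locales
  \<comment> \<open>Elements of \<open>UP R\<close> need finite support, so \<open>c\<close> is cut
    off beyond \<open>d\<close>.\<close>
  define f where "f = (\<lambda>i. if i \<le> d then c i else \<zero>)"
  have f: "f \<in> carrier (UP R)"
    using c by (auto simp: UP_def f_def intro!: exI[of _ d])
  have cf: "coeff (UP R) f j = f j" for j
    using f by (simp add: UP_def)
  have f0: "f \<noteq> \<zero>\<^bsub>UP R\<^esub>"
    using ne i by (auto simp: UP_def f_def fun_eq_iff)
  have dg: "deg R f \<le> d"
    using f by (intro U.deg_aboveI) (simp_all only: cf, simp add: f_def)
  have "eval R R id x f = \<zero>" if x: "x \<in> carrier R" for x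
  proof -
    have "eval R R id x f = (\<Oplus>j\<in>{..deg R f}. f j \<otimes> x [^] j)"
      using f by (simp add: eval_def cf)
    \<comment> \<open>\<open>eval\<close> sums only up to the true degree of \<open>f\<close>, which
      may be smaller than \<open>d\<close>; the coefficients in between are zero.\<close>
    also have "\<dots> = (\<Oplus>j\<in>{..d}. c j \<otimes> x [^] j)"
    proof (rule add.finprod_mono_neutral_cong_left)
      show "c j \<otimes> x [^] j = \<zero>" if "j \<in> {..d} - {..deg R f}" for j
      proof -
        from that have "f j = \<zero>" "j \<le> d"
          using U.deg_aboveD[OF _ f, of j] by (auto simp: cf)
        then show "c j \<otimes> x [^] j = \<zero>"
          using x by (simp add: f_def)
      qed
    qed (use dg c x in \<open>auto simp: f_def\<close>)
    finally show ?thesis using z[OF x] by simp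
  qed
  then have "{a \<in> carrier R. eval R R id a f = \<zero>} = carrier R" by auto
  then show False
    using U.roots_bound[OF f f0 fin] dg d by simp
qed

lemma (in domain) pow_eq_zero:
  assumes "x \<in> carrier R" "x [^] (n::nat) = \<zero>"
  shows "x = \<zero>"
  using assms(2) by (induction n) (auto simp: assms(1) integral_iff)

text \<open>The order \<open>p ^ n\<close> of the additive group annihilates 1, and
  \<open>p ^ n\<close> times 1 is the \<open>n\<close>-th power of \<open>p\<close> times 1. A field
  has no nonzero nilpotent elements.\<close>

lemma (in field) char_of_card_prime_power:
  assumes fin: "finite (carrier R)" and card: "card (carrier R) = p ^ n"
  shows "[p] \<cdot> \<one> = \<zero>"
proof -
  have "[(p ^ n)] \<cdot> \<one> = \<zero>"
    using add.pow_order_eq_1[of \<one>] fin card by (simp add: order_def)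
  moreover have "[(p ^ n)] \<cdot> \<one> = ([p] \<cdot> \<one>) [^] n"
  proof (induction n)
    case (Suc n)
    have "[(p ^ Suc n)] \<cdot> \<one> = [p] \<cdot> ([(p ^ n)] \<cdot> \<one>)"
      by (simp add: add.nat_pow_pow mult.commute)
    then show ?case
      by (simp add: Suc add_pow_rdistr)
  qed simp
  ultimately show ?thesis
    using pow_eq_zero[of "[p] \<cdot> \<one>" n] by auto
qed

text \<open>
  Split \<open>r = p^l * s\<close> with \<open>s\<close> prime to \<open>p\<close>. As Frobenius is injective, the power map \<open>s\<close> is
  additive too, so \<open>(X + 1)^s - X^s - 1\<close>, of degree less than the number of elements, vanishes
  identically; its linear coefficient is \<open>s\<close> unless \<open>s = 1\<close>.
\<close>

lemma (in field) additive_power_is_frobenius: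
  assumes fin: "finite (carrier R)" and p: "prime p" and card: "card (carrier R) = p ^ n"
    and r: "0 < r" "r < p ^ n"
    and add: "\<And>x. x \<in> carrier R \<Longrightarrow> (x \<oplus> \<one>) [^] r = x [^] r \<oplus> \<one>"
  shows "\<exists>l<n. r = p ^ l"
proof -
  have char: "[p] \<cdot> \<one> = \<zero>" by (rule char_of_card_prime_power[OF fin card])
  have p1: "p > 1" using p by (rule prime_gt_1_nat)
  obtain l s where rs: "r = p ^ l * s" and s: "\<not> p dvd s"
    using multiplicity_decompose'[of r p] p1 r(1)
    by (metis nat_dvd_1_iff_1 nat_neq_iff)
  have s0: "s > 0" using rs r by (cases s) auto
  have lr: "p ^ l \<le> r" using rs s0 by simp
  have ln: "l < n"
    using lr r p1 by (meson le_less_trans power_less_imp_less_exp)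
  have cop: "coprime (p ^ l) (p ^ n - 1)"
    using ln by (intro coprime_pow_minus_one[OF p1]) simp
  have bij: "bij_betw (\<lambda>a. a [^] (p ^ l)) (carrier R) (carrier R)"
    using cop lr r p1 by (intro field_pow_bij[OF field_axioms fin]) (auto simp: card in_totatives_iff)
  have adds: "(x \<oplus> \<one>) [^] s = x [^] s \<oplus> \<one>" if x: "x \<in> carrier R" for x
  proof -
    have "((x \<oplus> \<one>) [^] s) [^] (p ^ l) = (x [^] s \<oplus> \<one>) [^] (p ^ l)"
      using x add[OF x] by (simp add: frobenius_add[OF p char] nat_pow_pow rs mult.commute)
    then show ?thesis using bij x by (auto simp: bij_betw_def inj_on_def)
  qed
  have "s = 1"
  proof (rule ccontr)
    assume "s \<noteq> 1"
    then obtain d where d: "s = Suc d" "d \<ge> 1" using s0 by (cases s) auto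
    \<comment> \<open>The coefficients of (X + 1)^s - X^s - 1: the constant term cancels, and X^s is
      removed by summing only up to \<open>d = s - 1\<close>.\<close>
    define c where "c = (\<lambda>i. if i = 0 then \<zero> else [(s choose i)] \<cdot> \<one>)"
    have "(\<Oplus>i\<in>{..d}. c i \<otimes> x [^] i) = \<zero>" if x: "x \<in> carrier R" for x
    proof -
      let ?f = "\<lambda>i. [(s choose i)] \<cdot> \<one> \<otimes> x [^] i"
      let ?S = "(\<Oplus>i\<in>{..d}. c i \<otimes> x [^] i)"
      have f: "?f i \<in> carrier R" "c i \<in> carrier R" for i using x by (auto simp: c_def)
      have "(x \<oplus> \<one>) [^] s = (\<Oplus>i\<in>{..s}. ?f i)"
        using x by (subst binomial_expansion) (auto intro!: add.finprod_cong' simp: add_pow_ldistr)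
      also have "\<dots> = x [^] s \<oplus> (\<Oplus>i\<in>{..d}. ?f i)"
        using x f unfolding d(1) by (subst finsum_Suc) (auto simp: d(1))
      also have "(\<Oplus>i\<in>{..d}. ?f i) = ?S \<oplus> \<one>"
      proof -
        obtain e where e: "d = Suc e" using d(2) by (cases d) auto
        have "(\<Oplus>i\<in>{..d}. ?f i) = (\<Oplus>i\<in>{..e}. ?f (Suc i)) \<oplus> \<one>"
          using x f unfolding e by (subst finsum_Suc2) (auto simp: e)
        also have "(\<Oplus>i\<in>{..e}. ?f (Suc i)) = ?S"
          using x f unfolding e by (subst finsum_Suc2) (auto simp: c_def)
        finally show ?thesis .
      qed
      finally have eq: "x [^] s \<oplus> \<one> = x [^] s \<oplus> (?S \<oplus> \<one>)" using adds[OF x] by simp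
      have S: "?S \<in> carrier R" using x f by (intro finsum_closed) auto
      then have "x [^] s \<oplus> (?S \<oplus> \<one>) = ?S \<oplus> (x [^] s \<oplus> \<one>)"
        using x by (simp add: a_lcomm)
      then show ?thesis
        using eq x S by simp
    qed
    moreover have "d < card (carrier R)"
    proof -
      have "s \<le> r" using rs p1 by simp
      then show ?thesis using d(1) r(2) by (simp add: card)
    qed
    \<comment> \<open>As \<open>s > 1\<close>, the linear coefficient is among the indices up to
      \<open>d\<close>; it equals \<open>s\<close> times 1.\<close>
    ultimately have "c 1 = \<zero>"
      using vanishing_polynomial_function[OF fin, of d c 1] d(2) by (auto simp: c_def)
    then have s1: "[s] \<cdot> \<one> = \<zero>" using d by (simp add: c_def)
    \<comment> \<open>Both \<open>s\<close> and \<open>p\<close> annihilate 1, so a Bezout relation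
      between them would make 1 equal to 0.\<close>
    have "coprime s p" using s p by (simp add: coprime_commute prime_imp_coprime)
    then obtain u v where uv: "s * u = p * v + 1"
      using coprime_bezout_strong[of s p] p1 by auto
    have "[(s * u)] \<cdot> \<one> = \<zero>" "[(p * v)] \<cdot> \<one> = \<zero>"
      using add_pow_char_dvd[OF s1, of "s * u" \<one>] add_pow_char_dvd[OF char, of "p * v" \<one>] by auto
    then show False using uv by simp
  qed
  then show ?thesis using rs ln by auto
qed

section \<open>Isomorphisms of near-vector spaces determined by sequences\<close>

lemma (in field) pow_cong:
  assumes fin: "finite (carrier R)" and x: "x \<in> carrier R - {\<zero>}"
    and ab: "[a = b] (mod (card (carrier R) - 1))"
  shows "x [^] a = x [^] (b::nat)"
proof -
  interpret G: group "mult_of R" by (rule field_mult_group)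
  let ?M = "card (carrier R) - 1"
  \<comment> \<open>Fermat's theorem. Zero has to be excluded: the exponents 0 and \<open>?M\<close>
    are congruent, but zero to the power 0 is 1.\<close>
  have "x [^] ?M = \<one>"
    using G.pow_order_eq_1[of x] x fin by (simp add: order_mult_of nat_pow_mult_of order_def)
  then have "x [^] c = x [^] (c mod ?M)" for c
    using x nat_pow_mult[of x "?M * (c div ?M)" "c mod ?M"] by (simp flip: nat_pow_pow)
  then show ?thesis using ab by (metis cong_def)
qed

lemma (in field) nonzero_pow:
  assumes "x \<in> carrier R - {\<zero>}"
  shows "x [^] (k::nat) \<in> carrier R - {\<zero>}"
  using assms pow_eq_zero[of x k] by auto

lemma (in field) card_minus_one_pos:
  assumes fin: "finite (carrier R)"
  shows "card (carrier R) - 1 > 0"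
proof -
  have "card {\<zero>, \<one>} \<le> card (carrier R)" by (rule card_mono[OF fin]) auto
  then show ?thesis by simp
qed

lemma (in field) pow_iso:
  assumes fin: "finite (carrier R)" and k: "coprime k (card (carrier R) - 1)"
  shows "(\<lambda>a. a [^] k) \<in> iso (mult_of R) (mult_of R)"
proof -
  \<comment> \<open>\<open>field_pow_bij\<close> asks for an exponent in \<open>totatives\<close>,
    while \<open>k\<close> is any number in the residue class, even 0 when the field has two
    elements.\<close>
  obtain r where r: "r \<in> totatives (card (carrier R) - 1)" "[r = k] (mod (card (carrier R) - 1))"
    using ex_totative_cong[OF k card_minus_one_pos[OF fin]] by auto
  have inj: "inj_on (\<lambda>a. a [^] k) (carrier R - {\<zero>})"
  proof (rule inj_onI)
    fix x y assume xy: "x \<in> carrier R - {\<zero>}" "y \<in> carrier R - {\<zero>}" and "x [^] k = y [^] k"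
    then have "x [^] r = y [^] r" using pow_cong[OF fin _ r(2)] by simp
    then show "x = y"
      using field_pow_bij[OF field_axioms fin r(1)] xy by (auto simp: bij_betw_def inj_on_def)
  qed
  have "(\<lambda>a. a [^] k) ` (carrier R - {\<zero>}) = carrier R - {\<zero>}"
    using nonzero_pow fin by (intro endo_inj_surj[OF _ _ inj]) auto
  then show ?thesis
    using inj nonzero_pow by (auto simp: iso_def hom_def bij_betw_def nat_pow_distrib)
qed

text \<open>Here zero is included, hence the demand that \<open>k\<close> be positive: in the field
  with two elements 0 is coprime to the group order 1, and the power 0 sends both elements to
  1.\<close>

lemma (in field) pow_inj:
  assumes fin: "finite (carrier R)" and k: "coprime k (card (carrier R) - 1)" and k0: "k > 0"
  shows "inj_on (\<lambda>a. a [^] k) (carrier R)"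
proof (rule inj_onI)
  fix x y assume xy: "x \<in> carrier R" "y \<in> carrier R" "x [^] k = y [^] k"
  show "x = y"
  proof (cases "x = \<zero> \<or> y = \<zero>")
    case True
    then show ?thesis using xy pow_eq_zero[of x k] pow_eq_zero[of y k] nat_pow_zero k0 by force
  next
    case False
    then show ?thesis using pow_iso[OF fin k] xy by (auto simp: iso_def bij_betw_def inj_on_def)
  qed
qed

text \<open>The group is cyclic, so \<open>f\<close> is determined by its value \<open>g ^ k\<close>
  at a generator \<open>g\<close>. Injectivity of \<open>f\<close> then forces \<open>k\<close> to
  be prime to the group order.\<close>

lemma (in field) mult_of_automorphism_is_pow:
  assumes fin: "finite (carrier R)" and f: "f \<in> iso (mult_of R) (mult_of R)"
  shows "\<exists>k. coprime k (card (carrier R) - 1) \<and> (\<forall>a\<in>carrier R - {\<zero>}. f a = a [^] k)"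
proof -
  interpret G: group "mult_of R" by (rule field_mult_group)
  interpret h: group_hom "mult_of R" "mult_of R" f
    using f G.is_group by (simp add: group_hom_def group_hom_axioms_def iso_def)
  define M where "M = card (carrier R) - 1"
  have M: "M > 0" unfolding M_def by (rule card_minus_one_pos[OF fin])
  obtain g where g: "g \<in> carrier R - {\<zero>}" and gen: "carrier R - {\<zero>} = {g [^] i | i::nat. i \<in> UNIV}"
    using finite_field_mult_group_has_gen[OF fin] unfolding carrier_mult_of by blast
  have fc: "f a \<in> carrier R - {\<zero>}" if "a \<in> carrier R - {\<zero>}" for a
    using h.hom_closed[of a] that by simp
  obtain k where k: "f g = g [^] (k::nat)"
    using fc[OF g] unfolding gen by auto
  have pow: "f a = a [^] k" if a': "a \<in> carrier R - {\<zero>}" for a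
  proof -
    obtain i :: nat where a: "a = g [^] i" using a' unfolding gen by blast
    have "f a = f g [^] i"
      using h.hom_nat_pow[of g i] g by (simp add: a nat_pow_mult_of)
    then show ?thesis using g by (simp add: a k nat_pow_pow mult.commute)
  qed
  have "coprime k M"
  proof -
    \<comment> \<open>The power \<open>?e = M div d\<close> of any element is mapped to 1, hence is
      1. So the equation x^?e = 1 has \<open>M\<close> solutions, while its degree allows only
      \<open>?e\<close>; thus \<open>d = 1\<close>.\<close>
    define d where "d = gcd k M"
    have d: "d > 0" "d dvd k" "d dvd M" using M by (auto simp: d_def)
    let ?e = "M div d"
    have e: "?e > 0" using d M by (auto simp: div_greater_zero_iff dvd_imp_le)
    have "x [^] ?e = \<one>" if x: "x \<in> carrier R - {\<zero>}" for x
    proof -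
      have xe: "x [^] ?e \<in> carrier R - {\<zero>}" by (rule nonzero_pow[OF x])
      have "?e * k = M * (k div d)" using d by (auto elim!: dvdE)
      then have "f (x [^] ?e) = x [^] (M * (k div d))"
        using x by (simp add: pow[OF xe] nat_pow_pow)
      also have "\<dots> = x [^] (0::nat)"
        by (rule pow_cong[OF fin x]) (simp add: M_def cong_def)
      also have "\<dots> = f \<one>" using h.hom_one by simp
      finally show ?thesis
        using f xe by (auto simp: iso_def bij_betw_def inj_on_def)
    qed
    then have "carrier R - {\<zero>} \<subseteq> {x \<in> carrier R. x [^] ?e = \<one>}" by auto
    then have "card (carrier R - {\<zero>}) \<le> card {x \<in> carrier R. x [^] ?e = \<one>}"
      by (intro card_mono) (use fin in auto)
    also have "\<dots> \<le> ?e" using e by (intro num_roots_le_deg[OF fin]) simp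
    finally have "M \<le> ?e" by (simp add: M_def)
    then have "d = 1"
      using M d(1) div_less_dividend[of d M] by linarith
    then show ?thesis by (simp add: d_def coprime_iff_gcd_eq_1)
  qed
  then show ?thesis using pow by (auto simp: M_def)
qed

section \<open>Coordinates of vectors and the scalar group\<close>

lemma carrier_vec_group: "carrier (vec_group F m) = {..<m} \<rightarrow>\<^sub>E carrier F"
  by (simp add: vec_group_def)

lemma mult_vec_group: "x \<otimes>\<^bsub>vec_group F m\<^esub> y = (\<lambda>i\<in>{..<m}. x i \<oplus>\<^bsub>F\<^esub> y i)"
  by (simp add: vec_group_def)

lemma one_vec_group: "\<one>\<^bsub>vec_group F m\<^esub> = (\<lambda>i\<in>{..<m}. \<zero>\<^bsub>F\<^esub>)"
  by (simp add: vec_group_def)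

lemma (in field) group_vec_group: "group (vec_group R m)"
  unfolding vec_group_def by (intro product_group add.is_group)

lemma seq_scalar_apply:
  "x \<in> carrier (vec_group F (length qs)) \<Longrightarrow> i < length qs \<Longrightarrow>
    seq_scalar F qs a x i = x i \<otimes>\<^bsub>F\<^esub> a [^]\<^bsub>F\<^esub> (qs ! i)"
  by (simp add: seq_scalar_def)

lemma (in field) seq_scalar_closed:
  "x \<in> carrier (vec_group R (length qs)) \<Longrightarrow> a \<in> carrier R \<Longrightarrow>
    seq_scalar R qs a x \<in> carrier (vec_group R (length qs))"
  by (auto simp: seq_scalar_def carrier_vec_group)

lemma vec_group_eqI:
  "x \<in> carrier (vec_group F m) \<Longrightarrow> y \<in> carrier (vec_group F m) \<Longrightarrow> (\<And>i. i < m \<Longrightarrow> x i = y i) \<Longrightarrow> x = y"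
  unfolding carrier_vec_group by (rule PiE_ext) auto

text \<open>Identifies the scalar group with the multiplicative group of the field, so that
  isomorphisms between scalar groups become automorphisms of \<open>mult_of R\<close>.\<close>

lemma (in field) seq_scalar_iso:
  assumes fin: "finite (carrier R)" and m: "length qs > 0"
    and qs: "set qs \<subseteq> totatives (card (carrier R) - 1)"
  shows "seq_scalar R qs \<in>
    iso (mult_of R) (scalar_group (vec_group R (length qs)) (seq_scalars R qs))"
proof -
  let ?V = "vec_group R (length qs)" and ?s = "seq_scalar R qs"
  have q: "qs ! i \<in> totatives (card (carrier R) - 1)" if "i < length qs" for i
    using qs that by (meson nth_mem subsetD)
  have ext: "?s a \<in> extensional (carrier ?V)" for a
    by (simp add: seq_scalar_def)
  have zero: "?s \<zero> = zero_endo ?V"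
  proof (rule extensionalityI[OF ext])
    fix x assume x: "x \<in> carrier ?V"
    have "qs ! i > 0" if "i < length qs" for i using q[OF that] by (simp add: in_totatives_iff)
    then show "?s \<zero> x = zero_endo ?V x"
      using x by (auto simp: seq_scalar_def zero_endo_def one_vec_group nat_pow_zero carrier_vec_group
          PiE_iff intro!: restrict_ext)
  qed (simp add: zero_endo_def)
  have inj: "inj_on ?s (carrier R)"
  proof (rule inj_onI)
    fix a b assume ab: "a \<in> carrier R" "b \<in> carrier R" "?s a = ?s b"
    \<comment> \<open>Coordinate 0 of the image of the all-ones vector is the power
      \<open>qs ! 0\<close> of the scalar, which determines the scalar.\<close>
    define u where "u = (\<lambda>i\<in>{..<length qs}. \<one>)"
    have "u \<in> carrier ?V" by (auto simp: u_def carrier_vec_group)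
    then have "u 0 \<otimes> a [^] (qs ! 0) = u 0 \<otimes> b [^] (qs ! 0)"
      using m ab(3) by (simp flip: seq_scalar_apply)
    then have "a [^] (qs ! 0) = b [^] (qs ! 0)"
      using m ab by (simp add: u_def)
    then show "a = b"
      using field_pow_bij[OF field_axioms fin q[OF m]] ab by (auto simp: bij_betw_def inj_on_def)
  qed
  have carr: "?s ` (carrier R - {\<zero>}) = seq_scalars R qs - {zero_endo ?V}"
    using inj unfolding zero[symmetric] seq_scalars_def by (auto simp: inj_on_def)
  have "near_vector_space ?V (seq_scalars R qs)"
    by (rule near_vector_space_seq[OF field_axioms fin refl m qs])
  then have "subgroup (seq_scalars R qs - {zero_endo ?V}) (AutoGroup ?V)"
    by (simp add: near_vector_space_def)
  then have Bij: "?s a \<in> Bij (carrier ?V)" if "a \<in> carrier R - {\<zero>}" for a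
    using that subgroup.subset[of "seq_scalars R qs - {zero_endo ?V}" "AutoGroup ?V"]
    unfolding carr[symmetric] by (auto simp: AutoGroup_def auto_def)
  have "?s (a \<otimes> b) = ?s a \<otimes>\<^bsub>AutoGroup ?V\<^esub> ?s b"
    if ab: "a \<in> carrier R - {\<zero>}" "b \<in> carrier R - {\<zero>}" for a b
  proof -
    have "?s (a \<otimes> b) = compose (carrier ?V) (?s a) (?s b)"
    proof (rule extensionalityI[OF ext])
      fix x assume x: "x \<in> carrier ?V"
      have xb: "?s b x \<in> carrier ?V" using x ab seq_scalar_closed by simp
      have "?s (a \<otimes> b) x = ?s a (?s b x)"
      proof (rule vec_group_eqI[of _ R])
        fix i assume i: "i < length qs"
        have "x i \<in> carrier R" using x i by (auto simp: carrier_vec_group)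
        then show "?s (a \<otimes> b) x i = ?s a (?s b x) i"
          using x xb i ab by (simp add: seq_scalar_apply nat_pow_distrib m_ac)
      qed (use x xb ab seq_scalar_closed in auto)
      then show "?s (a \<otimes> b) x = compose (carrier ?V) (?s a) (?s b) x"
        using x by (simp add: compose_def)
    qed (simp add: compose_extensional)
    then show ?thesis
      using Bij[OF ab(1)] Bij[OF ab(2)] by (simp add: AutoGroup_def BijGroup_def)
  qed
  then show ?thesis
    using carr inj
    by (auto simp: iso_def hom_def scalar_group_def bij_betw_def inj_on_def)
qed

text \<open>Parametrizing both scalar groups by nonzero field elements turns \<open>\<eta>\<close>
  into an automorphism of a cyclic group, that is, a power map. The exponent \<open>k\<close> thus
  replaces \<open>\<eta>\<close>.\<close>

lemma (in field) nvs_isomorphic_seq_iff: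
  assumes fin: "finite (carrier R)" and m: "m > 0"
    and l1: "length qs1 = m" and l2: "length qs2 = m"
    and qs1: "set qs1 \<subseteq> totatives (card (carrier R) - 1)"
    and qs2: "set qs2 \<subseteq> totatives (card (carrier R) - 1)"
  shows "nvs_isomorphic (vec_group R m) (seq_scalars R qs1) (vec_group R m) (seq_scalars R qs2) \<longleftrightarrow>
    (\<exists>\<theta>\<in>iso (vec_group R m) (vec_group R m). \<exists>k. coprime k (card (carrier R) - 1) \<and>
      (\<forall>x\<in>carrier (vec_group R m). \<forall>a\<in>carrier R - {\<zero>}.
        \<theta> (seq_scalar R qs1 a x) = seq_scalar R qs2 (a [^] k) (\<theta> x)))"
    (is "?L \<longleftrightarrow> ?R")
proof -
  let ?V = "vec_group R m"
  let ?G1 = "scalar_group ?V (seq_scalars R qs1)" and ?G2 = "scalar_group ?V (seq_scalars R qs2)"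
  interpret G: group "mult_of R" by (rule field_mult_group)
  have s1: "seq_scalar R qs1 \<in> iso (mult_of R) ?G1"
    using seq_scalar_iso[OF fin _ qs1] m l1 by simp
  have s2: "seq_scalar R qs2 \<in> iso (mult_of R) ?G2"
    using seq_scalar_iso[OF fin _ qs2] m l2 by simp
  define t1 where "t1 = inv_into (carrier (mult_of R)) (seq_scalar R qs1)"
  define t2 where "t2 = inv_into (carrier (mult_of R)) (seq_scalar R qs2)"
  have t1: "t1 \<in> iso ?G1 (mult_of R)" and t2: "t2 \<in> iso ?G2 (mult_of R)"
    using G.iso_set_sym s1 s2 by (auto simp: t1_def t2_def)
  have c1: "carrier ?G1 = seq_scalars R qs1 - {zero_endo ?V}"
    by (simp add: scalar_group_def)
  have im1: "carrier ?G1 = seq_scalar R qs1 ` (carrier R - {\<zero>})"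
    using s1 by (simp add: iso_def bij_betw_def)
  show ?thesis
  proof
    assume ?L
    then obtain \<theta> \<eta> where th: "\<theta> \<in> iso ?V ?V" and et: "\<eta> \<in> iso ?G1 ?G2"
      and eq: "\<And>x f. x \<in> carrier ?V \<Longrightarrow> f \<in> carrier ?G1 \<Longrightarrow> \<theta> (f x) = \<eta> f (\<theta> x)"
      unfolding nvs_isomorphic_def c1 by blast
    define \<phi> where "\<phi> = t2 \<circ> (\<eta> \<circ> seq_scalar R qs1)"
    have "\<phi> \<in> iso (mult_of R) (mult_of R)"
      unfolding \<phi>_def by (rule iso_set_trans[OF iso_set_trans[OF s1 et] t2])
    then obtain k where k: "coprime k (card (carrier R) - 1)"
        "\<And>a. a \<in> carrier R - {\<zero>} \<Longrightarrow> \<phi> a = a [^] k"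
      using mult_of_automorphism_is_pow[OF fin] by blast
    have "\<theta> (seq_scalar R qs1 a x) = seq_scalar R qs2 (a [^] k) (\<theta> x)"
      if x: "x \<in> carrier ?V" and a: "a \<in> carrier R - {\<zero>}" for x a
    proof -
      have sa: "seq_scalar R qs1 a \<in> carrier ?G1" using a by (auto simp: im1)
      \<comment> \<open>\<open>t2\<close> is an \<open>inv_into\<close>, so it is undone by
        \<open>seq_scalar R qs2\<close> only on the image of the latter.\<close>
      then have "\<eta> (seq_scalar R qs1 a) \<in> seq_scalar R qs2 ` carrier (mult_of R)"
        using et s2 by (auto simp: iso_def bij_betw_def)
      then have "seq_scalar R qs2 (\<phi> a) = \<eta> (seq_scalar R qs1 a)"
        by (simp add: \<phi>_def t2_def f_inv_into_f)
      then show ?thesis using eq[OF x sa] k(2)[OF a] by simp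
    qed
    then show ?R using th k(1) by blast
  next
    assume ?R
    then obtain \<theta> k where th: "\<theta> \<in> iso ?V ?V" and k: "coprime k (card (carrier R) - 1)"
      and eq: "\<And>x a. x \<in> carrier ?V \<Longrightarrow> a \<in> carrier R - {\<zero>} \<Longrightarrow>
         \<theta> (seq_scalar R qs1 a x) = seq_scalar R qs2 (a [^] k) (\<theta> x)"
      by blast
    define \<eta> where "\<eta> = seq_scalar R qs2 \<circ> ((\<lambda>a. a [^] k) \<circ> t1)"
    have "\<eta> \<in> iso ?G1 ?G2"
      unfolding \<eta>_def by (rule iso_set_trans[OF iso_set_trans[OF t1 pow_iso[OF fin k]] s2])
    moreover have "\<theta> (f x) = \<eta> f (\<theta> x)" if x: "x \<in> carrier ?V" and f: "f \<in> carrier ?G1" for x f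
    proof -
      obtain a where a: "a \<in> carrier R - {\<zero>}" "f = seq_scalar R qs1 a"
        using f by (auto simp: im1)
      have "t1 f = a"
        using s1 a by (simp add: t1_def iso_def bij_betw_def)
      then show ?thesis using eq[OF x a(1)] by (simp add: \<eta>_def a(2))
    qed
    ultimately show ?L
      using th near_vector_space_seq[OF field_axioms fin l1 m qs1]
        near_vector_space_seq[OF field_axioms fin l2 m qs2]
      unfolding nvs_isomorphic_def c1 by blast
  qed
qed

section \<open>Supports of vectors under an isomorphism\<close>

text \<open>
  Rescaled by its value at \<open>\<one>\<close>, such an \<open>h\<close> is the power map with exponent \<open>b / a\<close>, and this power
  map is additive.
\<close>

lemma (in field) semilinear_imp_frob_equiv:
  assumes fin: "finite (carrier R)" and p: "prime p" and n: "n > 0" and card: "card (carrier R) = p ^ n"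
    and a: "coprime a (p ^ n - 1)" and b: "coprime b (p ^ n - 1)"
    and h: "\<And>x. x \<in> carrier R \<Longrightarrow> h x \<in> carrier R"
    and add: "\<And>x y. x \<in> carrier R \<Longrightarrow> y \<in> carrier R \<Longrightarrow> h (x \<oplus> y) = h x \<oplus> h y"
    and semi: "\<And>x t. x \<in> carrier R \<Longrightarrow> t \<in> carrier R - {\<zero>} \<Longrightarrow> h (x \<otimes> t [^] a) = h x \<otimes> t [^] b"
    and nz: "c \<in> carrier R" "h c \<noteq> \<zero>"
  shows "frob_equiv p n a b"
proof -
  have p1: "p > 1" using p by (rule prime_gt_1_nat)
  define M where "M = p ^ n - 1"
  have M: "M > 0" unfolding M_def by (rule pow_minus_one_pos[OF p1 n])
  have cM: "card (carrier R) - 1 = M" by (simp add: card M_def)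
  have pow: "x [^] i = x [^] j" if "x \<in> carrier R - {\<zero>}" "[i = j] (mod M)" for x and i j :: nat
    using pow_cong[OF fin that(1)] that(2) unfolding cM by blast
  \<comment> \<open>With \<open>u\<close> inverse to \<open>a\<close>, each nonzero \<open>x\<close>
    equals \<open>(x ^ u) ^ a\<close>, so semilinearity at 1 expresses \<open>h x\<close> through
    \<open>h \<one>\<close>.\<close>
  obtain u where u: "[a * u = 1] (mod M)"
    using cong_solve_coprime_nat[of a M] a by (auto simp: M_def)
  have "coprime u M"
    unfolding coprime_iff_invertible_nat using u by (auto simp: mult.commute intro: exI[of _ a])
  then have "coprime (u * b) M" using b by (simp add: M_def)
  \<comment> \<open>Reducing the exponent \<open>u * b\<close> brings it into the range required by
    \<open>additive_power_is_frobenius\<close>. It is also positive, so the formula for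
    \<open>h\<close> holds at zero.\<close>
  then obtain r where r: "r \<in> totatives M" "[r = u * b] (mod M)"
    using ex_totative_cong M by blast
  have r0: "0 < r" "r < p ^ n"
    using r(1) M by (auto simp: in_totatives_iff M_def)
  have h0: "h \<zero> = \<zero>"
    using add[of \<zero> \<zero>] h[of \<zero>] add.r_cancel_one'[of "h \<zero>" "h \<zero>"] by (metis l_zero zero_closed)
  have hx: "h x = h \<one> \<otimes> x [^] r" if x: "x \<in> carrier R" for x
  proof (cases "x = \<zero>")
    case True
    then show ?thesis using h[of \<one>] r0 h0 by (simp add: nat_pow_zero)
  next
    case False
    then have x0: "x \<in> carrier R - {\<zero>}" using x by simp
    have "x = x [^] (a * u)"
      using pow[OF x0 u] x by simp
    also have "\<dots> = \<one> \<otimes> (x [^] u) [^] a"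
      using x by (simp add: nat_pow_pow mult.commute)
    finally have "h x = h (\<one> \<otimes> (x [^] u) [^] a)" by (rule arg_cong)
    also have "\<dots> = h \<one> \<otimes> (x [^] u) [^] b"
      by (rule semi[OF _ nonzero_pow[OF x0]]) simp
    also have "(x [^] u) [^] b = x [^] r"
      using x pow[OF x0 r(2)] by (simp add: nat_pow_pow)
    finally show ?thesis .
  qed
  have h1: "h \<one> \<in> carrier R" "h \<one> \<noteq> \<zero>"
    using h[OF one_closed] hx[OF nz(1)] nz by auto
  have "(x \<oplus> \<one>) [^] r = x [^] r \<oplus> \<one>" if x: "x \<in> carrier R" for x
  proof -
    have "h \<one> \<otimes> (x \<oplus> \<one>) [^] r = h \<one> \<otimes> (x [^] r \<oplus> \<one>)"
    proof -
      have "h \<one> \<otimes> (x \<oplus> \<one>) [^] r = h (x \<oplus> \<one>)"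
        using x by (intro hx[symmetric]) simp
      also have "\<dots> = h x \<oplus> h \<one>"
        using x by (intro add) simp_all
      also have "\<dots> = h \<one> \<otimes> x [^] r \<oplus> h \<one>"
        by (simp only: hx[OF x])
      also have "\<dots> = h \<one> \<otimes> (x [^] r \<oplus> \<one>)"
        using x h1 by (simp add: r_distr)
      finally show ?thesis .
    qed
    then show ?thesis
      using x h1 by (subst (asm) m_lcancel) auto
  qed
  then obtain l where l: "r = p ^ l"
    using additive_power_is_frobenius[OF fin p card r0] by blast
  \<comment> \<open>Multiplying \<open>r = u * b\<close> by \<open>a\<close> recovers
    \<open>b\<close>, now as \<open>a\<close> times a power of \<open>p\<close>.\<close>
  have "[b = b * (a * u)] (mod M)"
    using cong_sym[OF cong_scalar_left[OF u, of b]] by simp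
  also have "[b * (a * u) = a * r] (mod M)"
    using cong_sym[OF cong_scalar_left[OF r(2), of a]] by (simp add: mult_ac)
  finally have "[b = a * p ^ l] (mod (p ^ n - 1))"
    by (simp only: l M_def)
  then have "frob_equiv p n b a"
    by (rule frob_equivI[OF p1 n])
  then show ?thesis by (rule frob_equiv_sym[OF p1 n])
qed

section \<open>Coordinate subspaces and the matrix entries of an isomorphism\<close>

definition supported :: "('a, 'b) ring_scheme \<Rightarrow> nat \<Rightarrow> nat set \<Rightarrow> (nat \<Rightarrow> 'a) set" where
  "supported F m I = {x \<in> carrier (vec_group F m). \<forall>i\<in>{..<m} - I. x i = \<zero>\<^bsub>F\<^esub>}"

text \<open>Cardinalities stand in for dimensions, because \<open>\<theta>\<close> is additive but
  need not be linear over the field.\<close>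

lemma (in field) card_supported:
  assumes fin: "finite (carrier R)" and I: "I \<subseteq> {..<m}"
  shows "card (supported R m I) = card (carrier R) ^ card I"
proof -
  have "bij_betw (\<lambda>x. restrict x I) (supported R m I) (I \<rightarrow>\<^sub>E carrier R)"
  proof (rule bij_betw_byWitness[where f' = "\<lambda>y. \<lambda>i\<in>{..<m}. if i \<in> I then y i else \<zero>"])
    show "\<forall>x\<in>supported R m I. (\<lambda>i\<in>{..<m}. if i \<in> I then restrict x I i else \<zero>) = x"
      by (auto simp: supported_def carrier_vec_group PiE_def extensional_def fun_eq_iff)
    show "\<forall>y\<in>I \<rightarrow>\<^sub>E carrier R. restrict (\<lambda>i\<in>{..<m}. if i \<in> I then y i else \<zero>) I = y"
    proof
      fix y assume "y \<in> I \<rightarrow>\<^sub>E carrier R"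
      then show "restrict (\<lambda>i\<in>{..<m}. if i \<in> I then y i else \<zero>) I = y"
        using I by (intro PiE_ext[of _ I "\<lambda>_. carrier R"]) auto
    qed
    show "(\<lambda>x. restrict x I) ` supported R m I \<subseteq> I \<rightarrow>\<^sub>E carrier R"
      using I by (auto simp: supported_def carrier_vec_group)
    show "(\<lambda>y. \<lambda>i\<in>{..<m}. if i \<in> I then y i else \<zero>) ` (I \<rightarrow>\<^sub>E carrier R) \<subseteq> supported R m I"
      by (intro image_subsetI) (auto simp: supported_def carrier_vec_group restrict_PiE_iff Pi_iff dest: PiE_mem)
  qed
  then have "card (supported R m I) = card (I \<rightarrow>\<^sub>E carrier R)"
    by (rule bij_betw_same_card)
  also have "\<dots> = card (carrier R) ^ card I"
    using I finite_subset by (subst card_PiE) auto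
  finally show ?thesis .
qed

definition single :: "('a, 'b) ring_scheme \<Rightarrow> nat \<Rightarrow> nat \<Rightarrow> 'a \<Rightarrow> nat \<Rightarrow> 'a" where
  "single F m i c = (\<lambda>j\<in>{..<m}. if j = i then c else \<zero>\<^bsub>F\<^esub>)"

lemma (in field) single_closed: "c \<in> carrier R \<Longrightarrow> single R m i c \<in> carrier (vec_group R m)"
  by (auto simp: single_def carrier_vec_group)

text \<open>A vector supported on \<open>I\<close> is a sum of vectors \<open>single R m i c\<close>
  with \<open>i\<close> in \<open>I\<close>, so a claim about an additive map reduces to its matrix
  entries.\<close>

lemma (in field) supported_induct:
  assumes "finite I" "I \<subseteq> {..<m}" "x \<in> supported R m I"
    and zero: "P (\<one>\<^bsub>vec_group R m\<^esub>)"
    and step: "\<And>y i c. y \<in> carrier (vec_group R m) \<Longrightarrow> i \<in> I \<Longrightarrow> c \<in> carrier R \<Longrightarrow> P y \<Longrightarrow>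
      P (y \<otimes>\<^bsub>vec_group R m\<^esub> single R m i c)"
  shows "P x"
  using assms(1-3) step
proof (induction I arbitrary: x rule: finite_induct)
  case empty
  have "x = \<one>\<^bsub>vec_group R m\<^esub>"
    using empty.prems(2) by (intro vec_group_eqI[of _ R m]) (auto simp: supported_def carrier_vec_group one_vec_group)
  then show ?case using zero by simp
next
  case (insert k I)
  have x: "x \<in> carrier (vec_group R m)" and k: "k < m"
    using insert.prems by (auto simp: supported_def)
  have xi: "x i \<in> carrier R" if "i < m" for i
    using x that by (auto simp: carrier_vec_group)
  define y where "y = (\<lambda>i\<in>{..<m}. if i = k then \<zero> else x i)"
  have y: "y \<in> supported R m I"
    using insert.prems(2) xi by (auto simp: y_def supported_def carrier_vec_group)
  then have yc: "y \<in> carrier (vec_group R m)" by (simp add: supported_def)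
  interpret V: group "vec_group R m" by (rule group_vec_group)
  have "x = y \<otimes>\<^bsub>vec_group R m\<^esub> single R m k (x k)"
  proof (rule vec_group_eqI[of _ R m])
    show "y \<otimes>\<^bsub>vec_group R m\<^esub> single R m k (x k) \<in> carrier (vec_group R m)"
      using yc single_closed[OF xi[OF k]] by (rule V.m_closed)
  qed (use x xi in \<open>auto simp: y_def single_def mult_vec_group\<close>)
  moreover have "P y"
  proof (rule insert.IH)
    show "P (z \<otimes>\<^bsub>vec_group R m\<^esub> single R m i c)"
      if "z \<in> carrier (vec_group R m)" "i \<in> I" "c \<in> carrier R" "P z" for z i c
      using that by (intro insert.prems(3)) auto
  qed (use insert.prems y in auto)
  ultimately show ?case
    using insert.prems(3)[OF yc _ xi[OF k], of k] by simp
qed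

text \<open>\<open>\<theta>\<close> maps vectors supported on \<open>?I\<close> injectively to
  vectors supported on \<open>?J\<close>: an entry from \<open>i\<close> in \<open>?I\<close> to
  \<open>j\<close> outside \<open>?J\<close> must vanish, since a nonzero one would put the
  exponents into one coset. Counting both sides gives the inequality.\<close>

lemma (in field) card_class_le:
  assumes fin: "finite (carrier R)" and p: "prime p" and n: "n > 0" and card: "card (carrier R) = p ^ n"
    and l1: "length qs1 = m" and l2: "length qs2 = m"
    and qs1: "set qs1 \<subseteq> totatives (p ^ n - 1)" and qs2: "set qs2 \<subseteq> totatives (p ^ n - 1)"
    and th: "\<theta> \<in> iso (vec_group R m) (vec_group R m)" and k: "coprime k (p ^ n - 1)"
    and semi: "\<And>x a. x \<in> carrier (vec_group R m) \<Longrightarrow> a \<in> carrier R - {\<zero>} \<Longrightarrow>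
        \<theta> (seq_scalar R qs1 a x) = seq_scalar R qs2 (a [^] k) (\<theta> x)"
  shows "card {i. i < m \<and> frob_equiv p n (qs1 ! i) c} \<le> card {j. j < m \<and> frob_equiv p n (k * qs2 ! j) c}"
    (is "card ?I \<le> card ?J")
proof -
  let ?V = "vec_group R m"
  interpret V: group ?V by (rule group_vec_group)
  interpret th: group_hom ?V ?V \<theta>
    using th V.is_group by (simp add: group_hom_def group_hom_axioms_def iso_def)
  have p1: "p > 1" using p by (rule prime_gt_1_nat)
  have th_single: "\<theta> (single R m i t) j = \<zero>"
    if i: "i \<in> ?I" and j: "j < m" "j \<notin> ?J" and t: "t \<in> carrier R" for i j t
  proof (rule ccontr)
    assume nz: "\<theta> (single R m i t) j \<noteq> \<zero>"
    have im: "i < m" using i by simp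
    have thc: "\<theta> x j \<in> carrier R" if "x \<in> carrier ?V" for x
      using th.hom_closed[OF that] j by (auto simp: carrier_vec_group)
    have "frob_equiv p n (qs1 ! i) (k * qs2 ! j)"
    \<comment> \<open>The map \<open>h\<close> is the matrix entry from coordinate \<open>i\<close>
      to coordinate \<open>j\<close>, with exponents \<open>qs1 ! i\<close> and
      \<open>k * qs2 ! j\<close>.\<close>
    proof (rule semilinear_imp_frob_equiv[OF fin p n card])
      show "coprime (qs1 ! i) (p ^ n - 1)" "coprime (k * qs2 ! j) (p ^ n - 1)"
        using subsetD[OF qs1, of "qs1 ! i"] subsetD[OF qs2, of "qs2 ! j"] k im j l1 l2
        by (auto simp: in_totatives_iff)
      show "\<theta> (single R m i (x \<oplus> y)) j = \<theta> (single R m i x) j \<oplus> \<theta> (single R m i y) j"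
        if "x \<in> carrier R" "y \<in> carrier R" for x y
      proof -
        have "single R m i (x \<oplus> y) = single R m i x \<otimes>\<^bsub>?V\<^esub> single R m i y"
          using that by (auto simp: single_def mult_vec_group)
        then have "\<theta> (single R m i (x \<oplus> y)) = \<theta> (single R m i x) \<otimes>\<^bsub>?V\<^esub> \<theta> (single R m i y)"
          using that by (simp add: single_closed)
        then show ?thesis
          using j(1) by (simp add: mult_vec_group)
      qed
      show "\<theta> (single R m i (x \<otimes> a [^] (qs1 ! i))) j = \<theta> (single R m i x) j \<otimes> a [^] (k * qs2 ! j)"
        if x: "x \<in> carrier R" and a: "a \<in> carrier R - {\<zero>}" for x a
      proof -
        have "single R m i (x \<otimes> a [^] (qs1 ! i)) = seq_scalar R qs1 a (single R m i x)"
          using x a l1 single_closed[of "x \<otimes> a [^] (qs1 ! i)" m i] single_closed[of x m i] seq_scalar_closed[of _ qs1]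
          by (intro vec_group_eqI[of _ R m]) (auto simp: seq_scalar_apply single_def)
        then have "\<theta> (single R m i (x \<otimes> a [^] (qs1 ! i))) = seq_scalar R qs2 (a [^] k) (\<theta> (single R m i x))"
          using x a by (simp add: semi single_closed)
        then show ?thesis
          using a j(1) l2 th.hom_closed[OF single_closed[OF x]] by (simp add: seq_scalar_apply nat_pow_pow)
      qed
      show "\<theta> (single R m i t) j \<noteq> \<zero>" by (rule nz)
    qed (use t thc single_closed in auto)
    then have "frob_equiv p n (k * qs2 ! j) c"
      using i frob_equiv_sym[OF p1 n] frob_equiv_trans[OF p1 n] by blast
    then show False using j by simp
  qed
  have "\<theta> x \<in> supported R m ?J" if x: "x \<in> supported R m ?I" for x
  proof -
    have "\<theta> x j = \<zero>" if j: "j < m" "j \<notin> ?J" for j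
    proof (rule supported_induct[OF _ _ x, where P = "\<lambda>x. \<theta> x j = \<zero>"])
      show "\<theta> \<one>\<^bsub>?V\<^esub> j = \<zero>"
        using th.hom_one j(1) by (simp add: one_vec_group)
      show "\<theta> (y \<otimes>\<^bsub>?V\<^esub> single R m i c) j = \<zero>"
        if y: "y \<in> carrier ?V" "\<theta> y j = \<zero>" and i: "i \<in> ?I" and c: "c \<in> carrier R" for y i c
      proof -
        have "\<theta> (y \<otimes>\<^bsub>?V\<^esub> single R m i c) = \<theta> y \<otimes>\<^bsub>?V\<^esub> \<theta> (single R m i c)"
          using y c by (simp add: single_closed)
        then show ?thesis
          using j(1) y(2) th_single[OF i j c] by (simp add: mult_vec_group)
      qed
    qed auto
    then show ?thesis
      using th.hom_closed x by (auto simp: supported_def)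
  qed
  moreover have "inj_on \<theta> (supported R m ?I)"
    using th by (auto simp: iso_def bij_betw_def supported_def intro: inj_on_subset)
  moreover have "finite (supported R m ?J)"
  proof (rule finite_subset)
    show "finite (carrier ?V)"
      unfolding carrier_vec_group using fin by (intro finite_PiE) auto
  qed (auto simp: supported_def)
  ultimately have "card (supported R m ?I) \<le> card (supported R m ?J)"
    by (intro card_inj_on_le) auto
  then have "card (carrier R) ^ card ?I \<le> card (carrier R) ^ card ?J"
    by (subst (asm) (1 2) card_supported[OF fin]) auto
  then show ?thesis
    using card_minus_one_pos[OF fin] by (intro power_le_imp_le_exp) auto
qed

section \<open>Multisets of exponents\<close>

lemma count_mset_nth: "count (mset xs) c = card {i. i < length xs \<and> xs ! i = c}"
  unfolding count_mset count_list_eq_length_filter length_filter_conv_card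
  by (simp add: eq_commute)

text \<open>Turns the condition on sets of entries and numbers of occurrences into one multiset
  equation. Injectivity keeps occurrences of different entries from being merged by
  \<open>f\<close>.\<close>

lemma mset_eq_map_iff:
  assumes inj: "inj_on f (set ys)"
  shows "mset xs = mset (map f ys) \<longleftrightarrow>
    set xs = f ` set ys \<and> (\<forall>y\<in>set ys. count_list xs (f y) = count_list ys y)"
proof
  assume eq: "mset xs = mset (map f ys)"
  have "set xs = f ` set ys"
    using mset_eq_setD[OF eq] by simp
  moreover have "count_list xs (f y) = count_list ys y" if "y \<in> set ys" for y
    using arg_cong[OF eq, of "\<lambda>M. count M (f y)"] count_list_inj_map[OF inj that]
    by (simp only: count_mset)
  ultimately show "set xs = f ` set ys \<and> (\<forall>y\<in>set ys. count_list xs (f y) = count_list ys y)"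
    by blast
next
  assume R: "set xs = f ` set ys \<and> (\<forall>y\<in>set ys. count_list xs (f y) = count_list ys y)"
  have "count_list xs c = count_list (map f ys) c" for c
  proof (cases "c \<in> f ` set ys")
    case True
    then show ?thesis using R count_list_inj_map[OF inj] by auto
  next
    case False
    then show ?thesis using R by simp
  qed
  then show "mset xs = mset (map f ys)"
    by (intro multiset_eqI) (simp only: count_mset)
qed

lemma suitable_seqD:
  assumes "suitable_seq p n m qs"
  shows "length qs = m" "set qs \<subseteq> totatives (p ^ n - 1)" "q \<in> set qs \<Longrightarrow> coset_rep p n q = q"
    "q \<in> set qs \<Longrightarrow> coprime q (p ^ n - 1)"
  using assms by (auto simp: suitable_seq_def in_totatives_iff)

text \<open>Multiplication by \<open>q\<close> is invertible on cosets, and distinct entries of a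
  suitable sequence lie in distinct cosets because each is its own representative.\<close>

lemma inj_on_coset_rep_mult:
  assumes p1: "p > 1" and n: "n > 0" and q: "coprime q (p ^ n - 1)" and qs: "suitable_seq p n m qs"
  shows "inj_on (\<lambda>q'. coset_rep p n (q * q')) (set qs)"
proof (rule inj_onI)
  fix a b assume ab: "a \<in> set qs" "b \<in> set qs" "coset_rep p n (q * a) = coset_rep p n (q * b)"
  have "frob_equiv p n (q * a) (q * b)"
    using ab(3) coset_rep_eq_iff[OF p1 n, of "q * a" "q * b"] q suitable_seqD(4)[OF qs ab(1)]
      suitable_seqD(4)[OF qs ab(2)] by simp
  then have "coset_rep p n a = coset_rep p n b"
    by (rule coset_rep_eqI[OF p1 n frob_equiv_mult_left_cancel[OF p1 n _ q]])
  then show "a = b" using ab suitable_seqD(3)[OF qs] by simp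
qed

text \<open>
  The number of coordinates whose exponents lie in a given coset cannot decrease, coset by coset; as
  both sequences have length \<open>m\<close>, it is constant.
\<close>

lemma (in field) isomorphic_imp_mset_eq:
  assumes fin: "finite (carrier R)" and p: "prime p" and n: "n > 0" and card: "card (carrier R) = p ^ n"
    and qs1: "suitable_seq p n m qs1" and qs2: "suitable_seq p n m qs2"
    and th: "\<theta> \<in> iso (vec_group R m) (vec_group R m)" and k: "coprime k (p ^ n - 1)"
    and semi: "\<And>x a. x \<in> carrier (vec_group R m) \<Longrightarrow> a \<in> carrier R - {\<zero>} \<Longrightarrow>
        \<theta> (seq_scalar R qs1 a x) = seq_scalar R qs2 (a [^] k) (\<theta> x)"
  shows "mset qs1 = mset (map (\<lambda>q'. coset_rep p n (k * q')) qs2)"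
proof -
  have p1: "p > 1" using p by (rule prime_gt_1_nat)
  note l1 = suitable_seqD(1)[OF qs1] and l2 = suitable_seqD(1)[OF qs2]
  let ?L = "map (\<lambda>q'. coset_rep p n (k * q')) qs2"
  have "count (mset qs1) c \<le> count (mset ?L) c" for c
  proof (cases "c \<in> set qs1")
    case False
    then have "count (mset qs1) c = 0" by (simp add: count_eq_zero_iff)
    then show ?thesis by (simp only: le0)
  next
    case True
    note c = suitable_seqD(3,4)[OF qs1 True]
    \<comment> \<open>Both numbers are the representatives of their cosets, so equality and
      equivalence coincide.\<close>
    have "qs1 ! i = c \<longleftrightarrow> frob_equiv p n (qs1 ! i) c" if "i < m" for i
      using that l1 coset_rep_eq_iff[OF p1 n suitable_seqD(4)[OF qs1] c(2), of "qs1 ! i"] c(1)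
        suitable_seqD(3)[OF qs1, of "qs1 ! i"] by simp
    then have "count (mset qs1) c = card {i. i < m \<and> frob_equiv p n (qs1 ! i) c}"
      unfolding count_mset_nth l1 by (metis (lifting))
    also have "\<dots> \<le> card {j. j < m \<and> frob_equiv p n (k * qs2 ! j) c}"
      by (rule card_class_le[OF fin p n card l1 l2 suitable_seqD(2)[OF qs1] suitable_seqD(2)[OF qs2] th k semi])
    also have "{j. j < m \<and> frob_equiv p n (k * qs2 ! j) c} = {j. j < m \<and> ?L ! j = c}"
    proof -
      have "?L ! j = c \<longleftrightarrow> frob_equiv p n (k * qs2 ! j) c" if "j < m" for j
      proof -
        have "coprime (k * qs2 ! j) (p ^ n - 1)"
          using k suitable_seqD(4)[OF qs2, of "qs2 ! j"] that l2 by simp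
        from coset_rep_eq_iff[OF p1 n this c(2)] show ?thesis
          using that l2 c(1) by simp
      qed
      then show ?thesis by auto
    qed
    also have "card \<dots> = count (mset ?L) c"
      using count_mset_nth[of ?L c] l2 by simp
    finally show ?thesis .
  qed
  then have "mset qs1 \<subseteq># mset ?L" by (rule mset_subset_eqI)
  moreover have "size (mset qs1) = size (mset ?L)" using l1 l2 by simp
  ultimately show ?thesis
    by (metis mset_subset_size nless_le subset_mset.less_le)
qed

lemma (in field) mset_eq_imp_isomorphic:
  assumes fin: "finite (carrier R)" and p: "prime p" and n: "n > 0" and card: "card (carrier R) = p ^ n"
    and qs1: "suitable_seq p n m qs1" and qs2: "suitable_seq p n m qs2"
    and q: "coprime q (p ^ n - 1)"
    and eq: "mset qs1 = mset (map (\<lambda>q'. coset_rep p n (q * q')) qs2)"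
  shows "\<exists>\<theta>\<in>iso (vec_group R m) (vec_group R m).
    \<forall>x\<in>carrier (vec_group R m). \<forall>a\<in>carrier R - {\<zero>}.
        \<theta> (seq_scalar R qs1 a x) = seq_scalar R qs2 (a [^] q) (\<theta> x)"
proof -
  let ?V = "vec_group R m"
  have p1: "p > 1" using p by (rule prime_gt_1_nat)
  note l1 = suitable_seqD(1)[OF qs1] and l2 = suitable_seqD(1)[OF qs2]
  \<comment> \<open>Equal multisets give a matching of coordinates: position \<open>j\<close> of the
    target is paired with position \<open>\<pi> j\<close> of the source, in the same coset after
    multiplication by \<open>q\<close>.\<close>
  obtain \<pi> where \<pi>: "\<pi> permutes {..<m}" and perm: "permute_list \<pi> qs1 = map (\<lambda>q'. coset_rep p n (q * q')) qs2"
    using mset_eq_permutation[OF eq[symmetric]] l1 by metis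
  have \<pi>m: "\<pi> j < m" if "j < m" for j
    using permutes_in_image[OF \<pi>, of j] that by simp
  have "\<exists>l. [q * qs2 ! j = qs1 ! \<pi> j * p ^ l] (mod (p ^ n - 1))" if j: "j < m" for j
  proof -
    have "qs1 ! \<pi> j = coset_rep p n (q * qs2 ! j)"
      using arg_cong[OF perm, of "\<lambda>xs. xs ! j"] permute_list_nth[of \<pi> qs1 j] \<pi> j l1 l2 by simp
    moreover have "coprime (q * qs2 ! j) (p ^ n - 1)"
      using q suitable_seqD(4)[OF qs2, of "qs2 ! j"] j l2 by simp
    ultimately have "frob_equiv p n (q * qs2 ! j) (qs1 ! \<pi> j)"
      using coset_rep_in_coset(2)[OF p1 n] frob_equiv_sym[OF p1 n] by metis
    then show ?thesis by (auto simp: frob_equiv_def)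
  qed
  then obtain l where l: "\<And>j. j < m \<Longrightarrow> [q * qs2 ! j = qs1 ! \<pi> j * p ^ l j] (mod (p ^ n - 1))"
    by metis
  \<comment> \<open>The Frobenius power \<open>p ^ l j\<close> makes up the difference between
    \<open>qs1 ! \<pi> j\<close> and \<open>q * qs2 ! j\<close>, and being additive it keeps
    \<open>\<theta>\<close> a homomorphism.\<close>
  define \<theta> where "\<theta> = (\<lambda>x. \<lambda>j\<in>{..<m}. x (\<pi> j) [^] (p ^ l j))"
  have xc: "x i \<in> carrier R" if "x \<in> carrier ?V" "i < m" for x i
    using that by (auto simp: carrier_vec_group)
  have th: "\<theta> x \<in> carrier ?V" if "x \<in> carrier ?V" for x
    using xc[OF that] \<pi>m by (auto simp: \<theta>_def carrier_vec_group)
  have hom: "\<theta> \<in> hom ?V ?V"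
  proof (rule homI)
    fix x y assume xy: "x \<in> carrier ?V" "y \<in> carrier ?V"
    show "\<theta> (x \<otimes>\<^bsub>?V\<^esub> y) = \<theta> x \<otimes>\<^bsub>?V\<^esub> \<theta> y"
      using xc[OF xy(1)] xc[OF xy(2)] \<pi>m frobenius_add[OF p char_of_card_prime_power[OF fin card]]
      by (auto simp: \<theta>_def mult_vec_group intro!: restrict_ext)
  qed (rule th)
  \<comment> \<open>Injectivity suffices, since the vector group is finite. It holds coordinatewise
    because \<open>\<pi>\<close> reaches every index and Frobenius is injective.\<close>
  have "inj_on \<theta> (carrier ?V)"
  proof (rule inj_onI, rule vec_group_eqI[of _ R m])
    fix x y i assume xy: "x \<in> carrier ?V" "y \<in> carrier ?V" "\<theta> x = \<theta> y" and i: "i < m"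
    obtain j where j: "j < m" "i = \<pi> j"
      using permutes_image[OF \<pi>] i by (metis imageE lessThan_iff)
    have "x i [^] (p ^ l j) = y i [^] (p ^ l j)"
      using fun_cong[OF xy(3), of j] j by (simp add: \<theta>_def)
    moreover have "inj_on (\<lambda>a. a [^] (p ^ l j)) (carrier R)"
      using coprime_pow_minus_one[OF p1 n] p1 by (intro pow_inj[OF fin]) (simp_all add: card)
    ultimately show "x i = y i"
      using xc[OF xy(1) i] xc[OF xy(2) i] by (auto simp: inj_on_def)
  qed
  moreover have "finite (carrier ?V)"
    unfolding carrier_vec_group using fin by (intro finite_PiE) auto
  moreover from calculation have "\<theta> ` carrier ?V = carrier ?V"
    using th by (intro endo_inj_surj) auto
  ultimately have iso: "\<theta> \<in> iso ?V ?V"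
    using hom by (simp add: iso_def bij_betw_def)
  have "\<theta> (seq_scalar R qs1 a x) = seq_scalar R qs2 (a [^] q) (\<theta> x)"
    if x: "x \<in> carrier ?V" and a: "a \<in> carrier R - {\<zero>}" for x a
  proof (rule vec_group_eqI[of _ R m])
    fix j assume j: "j < m"
    have "\<theta> (seq_scalar R qs1 a x) j = (x (\<pi> j) \<otimes> a [^] (qs1 ! \<pi> j)) [^] (p ^ l j)"
      using x j \<pi>m[OF j] l1 by (simp add: \<theta>_def seq_scalar_apply)
    also have "\<dots> = \<theta> x j \<otimes> a [^] (qs1 ! \<pi> j * p ^ l j)"
      using a j xc[OF x \<pi>m[OF j]] by (simp add: \<theta>_def nat_pow_distrib nat_pow_pow)
    also have "a [^] (qs1 ! \<pi> j * p ^ l j) = a [^] (q * qs2 ! j)"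
      by (rule pow_cong[OF fin a, symmetric, unfolded card, OF l[OF j]])
    also have "\<theta> x j \<otimes> \<dots> = seq_scalar R qs2 (a [^] q) (\<theta> x) j"
      using a j th[OF x] l2 by (simp add: seq_scalar_apply nat_pow_pow)
    finally show "\<theta> (seq_scalar R qs1 a x) j = seq_scalar R qs2 (a [^] q) (\<theta> x) j" .
  qed (use a l1 l2 th th[OF x] seq_scalar_closed[of x qs1] seq_scalar_closed[of "\<theta> x" qs2] x in auto)
  then show ?thesis using iso by blast
qed

section \<open>The isomorphism criterion\<close>

theorem theorem3p2:
  fixes F :: "('a, 'b) ring_scheme"
    and p n m :: nat
    and qs1 qs2 :: "nat list"
  assumes "prime p" and "n \<ge> 1" and "m \<ge> 1"
    and "field F" and "finite (carrier F)" and "card (carrier F) = p ^ n"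
    and "suitable_seq p n m qs1" and "suitable_seq p n m qs2"
    and "qs1 ! 0 = 1" and "qs2 ! 0 = 1"
  shows "nvs_isomorphic (vec_group F m) (seq_scalars F qs1) (vec_group F m) (seq_scalars F qs2)
     \<longleftrightarrow> (\<exists>q\<in>set qs1.
            set qs1 = (\<lambda>q'. q \<otimes>\<^bsub>frob_quot p n\<^esub> q') ` set qs2 \<and>
            (\<forall>q'\<in>set qs2. count_list qs1 (q \<otimes>\<^bsub>frob_quot p n\<^esub> q') = count_list qs2 q'))"
    (is "?L \<longleftrightarrow> ?R")
proof -
  interpret F: field F by fact
  let ?V = "vec_group F m"
  have p1: "p > 1" using \<open>prime p\<close> by (rule prime_gt_1_nat)
  have n: "n > 0" and m: "m > 0" using \<open>n \<ge> 1\<close> \<open>m \<ge> 1\<close> by auto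
  note fin = \<open>finite (carrier F)\<close> and card = \<open>card (carrier F) = p ^ n\<close>
    and qs1 = \<open>suitable_seq p n m qs1\<close> and qs2 = \<open>suitable_seq p n m qs2\<close>
  have iso_iff: "?L \<longleftrightarrow> (\<exists>\<theta>\<in>iso ?V ?V. \<exists>k. coprime k (p ^ n - 1) \<and>
      (\<forall>x\<in>carrier ?V. \<forall>a\<in>carrier F - {\<zero>\<^bsub>F\<^esub>}.
        \<theta> (seq_scalar F qs1 a x) = seq_scalar F qs2 (a [^]\<^bsub>F\<^esub> k) (\<theta> x)))"
    using F.nvs_isomorphic_seq_iff[OF fin m suitable_seqD(1)[OF qs1] suitable_seqD(1)[OF qs2]]
      suitable_seqD(2)[OF qs1] suitable_seqD(2)[OF qs2] unfolding card by blast
  have R_iff: "?R \<longleftrightarrow> (\<exists>q\<in>set qs1. mset qs1 = mset (map (\<lambda>q'. coset_rep p n (q * q')) qs2))"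
    unfolding frob_quot_def monoid.select_convs
    using inj_on_coset_rep_mult[OF p1 n suitable_seqD(4)[OF qs1] qs2, THEN mset_eq_map_iff]
    by (intro bex_cong refl) blast
  show ?thesis
    unfolding R_iff
  proof
    assume ?L
    then obtain \<theta> k where th: "\<theta> \<in> iso ?V ?V" and k: "coprime k (p ^ n - 1)"
      and semi: "\<And>x a. x \<in> carrier ?V \<Longrightarrow> a \<in> carrier F - {\<zero>\<^bsub>F\<^esub>} \<Longrightarrow>
        \<theta> (seq_scalar F qs1 a x) = seq_scalar F qs2 (a [^]\<^bsub>F\<^esub> k) (\<theta> x)"
      unfolding iso_iff by blast
    \<comment> \<open>The exponent \<open>k\<close> is only some number prime to
      \<open>p ^ n - 1\<close>. Its representative gives the same products of cosets.\<close>
    define q where "q = coset_rep p n k"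
    have eq: "mset qs1 = mset (map (\<lambda>q'. coset_rep p n (k * q')) qs2)"
      by (rule F.isomorphic_imp_mset_eq[OF fin \<open>prime p\<close> n card qs1 qs2 th k semi])
    have "coset_rep p n (k * q') = coset_rep p n (q * q')" for q'
    proof (rule coset_rep_eqI[OF p1 n])
      have "frob_equiv p n (q' * q) (q' * k)"
        unfolding q_def by (rule frob_equiv_mult_left[OF p1 n coset_rep_in_coset(2)[OF p1 n k]])
      then show "frob_equiv p n (k * q') (q * q')"
        using frob_equiv_sym[OF p1 n] by (simp add: mult.commute)
    qed
    moreover have "q \<in> set qs1"
    proof -
      \<comment> \<open>The entry 1 of \<open>qs2\<close> is sent to the representative of
        \<open>k * 1\<close>, which is \<open>q\<close>; hence \<open>q\<close> occurs in
        \<open>qs1\<close>.\<close>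
      have "1 \<in> set qs2"
        using \<open>qs2 ! 0 = 1\<close> m suitable_seqD(1)[OF qs2] by (metis nth_mem)
      then show ?thesis
        using mset_eq_setD[OF eq] by (auto simp: q_def intro!: image_eqI[of _ _ 1])
    qed
    ultimately show "\<exists>q\<in>set qs1. mset qs1 = mset (map (\<lambda>q'. coset_rep p n (q * q')) qs2)"
      using eq by (simp only:) blast
  next
    assume "\<exists>q\<in>set qs1. mset qs1 = mset (map (\<lambda>q'. coset_rep p n (q * q')) qs2)"
    then obtain q where q: "q \<in> set qs1" "mset qs1 = mset (map (\<lambda>q'. coset_rep p n (q * q')) qs2)"
      by blast
    \<comment> \<open>In this direction \<open>q\<close> itself is the exponent of the power map on
      scalars.\<close>
    note cop = suitable_seqD(4)[OF qs1 q(1)]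
    show ?L
      unfolding iso_iff
      using F.mset_eq_imp_isomorphic[OF fin \<open>prime p\<close> n card qs1 qs2 cop q(2)] cop by blast
  qed
qed

end
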